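(* For every $n\ge1$, the set $\mathcal{W}_n$ of simultaneously triangularizable pairs of $n\times n$ quaternionic matrices is a semi-algebraic subset of $M_n(\mathbb{H})\times M_n(\mathbb{H})$ and is closed in the ordinary (Euclidean) topology.
   Context: $\mathbb{H}$ is the division ring of real quaternions; $M_n(\mathbb{H})$ is the space of $n\times n$ quaternionic matrices, regarded as a real vector space of dimension $4n^2$. $\mathcal{W}_n$ is the set of all pairs $(A,B)\in M_n(\mathbb{H})\times M_n(\mathbb{H})$ that are simultaneously triangularizable, i.e. for which there is $P\in\mathrm{GL}_n(\mathbb{H})$ such that $PAP^{-1}$ and $PBP^{-1}$ are both upper triangular. *)

theory Defs
  imports "HOL-Analysis.Analysis"
begin

codatatype quat = Quat (Re_q: real) (Im_i: real) (Im_j: real) (Im_k: real)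

lemma quat_eq_iff:
  "x = y \<longleftrightarrow> Re_q x = Re_q y \<and> Im_i x = Im_i y \<and> Im_j x = Im_j y \<and> Im_k x = Im_k y"
  by (auto intro: quat.expand)

instantiation quat :: ab_group_add
begin

primcorec zero_quat where
  "Re_q 0 = 0"
| "Im_i 0 = 0"
| "Im_j 0 = 0"
| "Im_k 0 = 0"

primcorec plus_quat where
  "Re_q (x + y) = Re_q x + Re_q y"
| "Im_i (x + y) = Im_i x + Im_i y"
| "Im_j (x + y) = Im_j x + Im_j y"
| "Im_k (x + y) = Im_k x + Im_k y"

primcorec uminus_quat where
  "Re_q (- x) = - Re_q x"
| "Im_i (- x) = - Im_i x"
| "Im_j (- x) = - Im_j x"
| "Im_k (- x) = - Im_k x"

primcorec minus_quat where
  "Re_q (x - y) = Re_q x - Re_q y"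
| "Im_i (x - y) = Im_i x - Im_i y"
| "Im_j (x - y) = Im_j x - Im_j y"
| "Im_k (x - y) = Im_k x - Im_k y"

instance
  by standard (simp_all add: quat_eq_iff)

end

definition quat_normsq :: "quat \<Rightarrow> real" where
  "quat_normsq x = (Re_q x)\<^sup>2 + (Im_i x)\<^sup>2 + (Im_j x)\<^sup>2 + (Im_k x)\<^sup>2"

lemma quat_normsq_eq_0_iff [simp]: "quat_normsq x = 0 \<longleftrightarrow> x = 0"
  by (auto simp: quat_normsq_def quat_eq_iff add_nonneg_eq_0_iff)

instantiation quat :: division_ring
begin

primcorec one_quat where
  "Re_q 1 = 1"
| "Im_i 1 = 0"
| "Im_j 1 = 0"
| "Im_k 1 = 0"

primcorec times_quat where
  "Re_q (x * y) = Re_q x * Re_q y - Im_i x * Im_i y - Im_j x * Im_j y - Im_k x * Im_k y"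
| "Im_i (x * y) = Re_q x * Im_i y + Im_i x * Re_q y + Im_j x * Im_k y - Im_k x * Im_j y"
| "Im_j (x * y) = Re_q x * Im_j y - Im_i x * Im_k y + Im_j x * Re_q y + Im_k x * Im_i y"
| "Im_k (x * y) = Re_q x * Im_k y + Im_i x * Im_j y - Im_j x * Im_i y + Im_k x * Re_q y"

primcorec inverse_quat where
  "Re_q (inverse x) = Re_q x / quat_normsq x"
| "Im_i (inverse x) = - Im_i x / quat_normsq x"
| "Im_j (inverse x) = - Im_j x / quat_normsq x"
| "Im_k (inverse x) = - Im_k x / quat_normsq x"

definition "x div y = x * inverse y" for x y :: quat

instance
proof
  fix x y z :: quat
  show "x * y * z = x * (y * z)"
    by (simp add: quat_eq_iff algebra_simps)
  show "(x + y) * z = x * z + y * z" "x * (y + z) = x * y + x * z"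
    by (simp_all add: quat_eq_iff algebra_simps)
  show "1 * x = x" "x * 1 = x" "(0 :: quat) \<noteq> 1"
    by (simp_all add: quat_eq_iff)
  show "x div y = x * inverse y"
    by (rule divide_quat_def)
  show "inverse (0 :: quat) = 0"
    by (simp add: quat_eq_iff)
  assume "x \<noteq> 0"
  then have nz: "quat_normsq x \<noteq> 0"
    by simp
  have one: "Re_q x * Re_q x / quat_normsq x + Im_i x * Im_i x / quat_normsq x
      + Im_j x * Im_j x / quat_normsq x + Im_k x * Im_k x / quat_normsq x = 1"
    using nz unfolding add_divide_distrib [symmetric]
    by (simp add: quat_normsq_def power2_eq_square)
  show "inverse x * x = 1" "x * inverse x = 1"
    using one by (simp_all add: quat_eq_iff algebra_simps)
qed

end

abbreviation quat_i :: quat where "quat_i \<equiv> Quat 0 1 0 0"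
abbreviation quat_j :: quat where "quat_j \<equiv> Quat 0 0 1 0"
abbreviation quat_k :: quat where "quat_k \<equiv> Quat 0 0 0 1"

lemma quat_units_mult:
  "quat_i * quat_i = -1" "quat_j * quat_j = -1" "quat_k * quat_k = -1"
  "quat_i * quat_j = quat_k" "quat_j * quat_k = quat_i" "quat_k * quat_i = quat_j"
  "quat_j * quat_i = - quat_k" "quat_k * quat_j = - quat_i" "quat_i * quat_k = - quat_j"
  by (simp_all add: quat_eq_iff)

instantiation quat :: real_div_algebra
begin

primcorec scaleR_quat where
  "Re_q (scaleR r x) = r * Re_q x"
| "Im_i (scaleR r x) = r * Im_i x"
| "Im_j (scaleR r x) = r * Im_j x"
| "Im_k (scaleR r x) = r * Im_k x"

instance
  by standard (simp_all add: quat_eq_iff algebra_simps)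

end

instantiation quat :: real_inner
begin

definition inner_quat_def:
  "inner x y = Re_q x * Re_q y + Im_i x * Im_i y + Im_j x * Im_j y + Im_k x * Im_k y"

definition norm_quat_def: "norm x = sqrt (quat_normsq x)"

definition sgn_quat_def: "sgn x = x /\<^sub>R norm x" for x :: quat

definition dist_quat_def: "dist x y = norm (x - y)" for x y :: quat

definition uniformity_quat_def:
  "(uniformity :: (quat \<times> quat) filter) = (INF e\<in>{0 <..}. principal {(x, y). dist x y < e})"

definition open_quat_def:
  "open (U :: quat set) \<longleftrightarrow> (\<forall>x\<in>U. eventually (\<lambda>(x', y). x' = x \<longrightarrow> y \<in> U) uniformity)"

instance
proof
  fix x y z :: quat and r :: real
  show "inner x y = inner y x" "inner (x + y) z = inner x z + inner y z"
    "inner (scaleR r x) y = r * inner x y"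
    by (simp_all add: inner_quat_def algebra_simps)
  have sq: "inner x x = quat_normsq x"
    by (simp add: inner_quat_def quat_normsq_def power2_eq_square)
  show "0 \<le> inner x x"
    unfolding sq by (simp add: quat_normsq_def)
  show "inner x x = 0 \<longleftrightarrow> x = 0"
    unfolding sq by simp
  show "norm x = sqrt (inner x x)"
    unfolding sq by (rule norm_quat_def)
qed (rule sgn_quat_def dist_quat_def open_quat_def uniformity_quat_def)+

end

instance quat :: real_normed_div_algebra
proof
  fix x y :: quat
  have "quat_normsq (x * y) = quat_normsq x * quat_normsq y"
    by (simp add: quat_normsq_def power2_eq_square algebra_simps)
  then show "norm (x * y) = norm x * norm y"
    by (simp add: norm_quat_def real_sqrt_mult)
qed

instantiation quat :: euclidean_space
begin

definition Basis_quat_def: "Basis = {1, quat_i, quat_j, quat_k}"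

instance
proof
  show "(Basis :: quat set) \<noteq> {}" "finite (Basis :: quat set)"
    by (simp_all add: Basis_quat_def)
next
  fix u v :: quat
  assume "u \<in> Basis" "v \<in> Basis"
  then show "inner u v = (if u = v then 1 else 0)"
    unfolding Basis_quat_def by (elim insertE emptyE) (simp_all add: inner_quat_def quat_eq_iff)
next
  fix x :: quat
  show "(\<forall>u\<in>Basis. inner x u = 0) \<longleftrightarrow> x = 0"
    unfolding Basis_quat_def ball_simps quat_eq_iff [of x 0] by (simp add: inner_quat_def)
qed

end

lemma DIM_quat [simp]: "DIM(quat) = 4"
  by (simp add: Basis_quat_def quat_eq_iff)

lemma DIM_quat_matrix: "DIM(quat^'n::finite^'n::finite) = 4 * CARD('n)\<^sup>2"
  by (simp add: power2_eq_square)


text \<open>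
  On a Euclidean space, \<^const>\<open>real_polynomial_function\<close> is the real algebra generated by the linear
  functionals, that is, the polynomial functions in the coordinates with respect to any basis.
\<close>

definition basic_semialgebraic :: "'a::euclidean_space set \<Rightarrow> bool" where
  "basic_semialgebraic S \<longleftrightarrow>
    (\<exists>F G. finite F \<and> finite G \<and>
      (\<forall>f \<in> F \<union> G. real_polynomial_function f) \<and>
      S = {x. (\<forall>f\<in>F. f x = 0) \<and> (\<forall>g\<in>G. g x > 0)})"

definition semialgebraic :: "'a::euclidean_space set \<Rightarrow> bool" where
  "semialgebraic S \<longleftrightarrow> (\<exists>C. finite C \<and> (\<forall>T\<in>C. basic_semialgebraic T) \<and> S = \<Union>C)"


type_synonym ('a, 'n) sqmat = "(('a, 'n) vec, 'n) vec"

definition upper_triangular :: "('a::zero, 'n::{finite,linorder}) sqmat \<Rightarrow> bool" where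
  "upper_triangular A \<longleftrightarrow> (\<forall>i j. j < i \<longrightarrow> A $ i $ j = 0)"

definition simultaneously_triangularizable ::
    "('a::semiring_1, 'n::{finite,linorder}) sqmat \<Rightarrow> ('a, 'n) sqmat \<Rightarrow> bool" where
  "simultaneously_triangularizable A B \<longleftrightarrow>
    (\<exists>P :: ('a, 'n) sqmat. invertible P \<and>
      upper_triangular (P ** A ** matrix_inv P) \<and>
      upper_triangular (P ** B ** matrix_inv P))"

text \<open>
  The index type \<open>'n\<close> is an arbitrary finite nonempty linear order, so it plays the role of
  \<open>{1, ..., n}\<close> with \<open>n = CARD('n) \<ge> 1\<close>.
\<close>

definition triangularizable_pairs ::
    "((quat, 'n::{finite,linorder}) sqmat \<times> (quat, 'n) sqmat) set" where
  "triangularizable_pairs = {(A, B). simultaneously_triangularizable A B}"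

end

theory Submission
  imports Defs "HOL-Computational_Algebra.Fundamental_Theorem_Algebra"
begin

text \<open>
  The pair \<open>(A, B)\<close> is simultaneously triangularizable iff \<open>tr (z\<^sup>2) \<le> 0\<close>, with \<open>tr\<close> the real part of
  the trace, for every real linear combination \<open>z\<close> of commutators \<open>[u, v]\<close> of words \<open>u, v\<close> in \<open>A\<close>
  and \<open>B\<close> of bounded length. This is the negative semidefiniteness of a symmetric matrix whose entries
  are polynomials in \<open>(A, B)\<close>: a closed condition, and a semialgebraic one by taking successive Schur
  complements, so no quantifier elimination is needed.

  If \<open>A\<close> and \<open>B\<close> are triangular, then the diagonal entries of \<open>z\<close> are sums of commutators of
  quaternions, hence purely imaginary, and have nonpositive squares. Conversely, let \<open>\<A>\<close> be the real
  algebra generated by \<open>A\<close> and \<open>B\<close>. The trace condition forces \<open>x y\<close> to be nilpotent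
  whenever \<open>x, y \<in> \<A>\<close> and \<open>x\<close> is nilpotent. This property passes to the algebra of operators on
  a simple subquotient \<open>W / U\<close> of the column space, as nilpotents lift. That algebra is therefore
  reduced, hence a division algebra, hence the reals, the complex numbers or the quaternions, and in each
  case there is a common right eigenvector. So \<open>W / U\<close> is one-dimensional, and \<open>A\<close> and \<open>B\<close>
  stabilize a full flag.
\<close>

section \<open>Semialgebraic and closed sets of semidefinite forms\<close>

lemma basic_semialgebraic_Int:
  assumes "basic_semialgebraic S" "basic_semialgebraic T"
  shows "basic_semialgebraic (S \<inter> T)"
proof -
  obtain F G where S: "finite F" "finite G" "\<forall>f \<in> F \<union> G. real_polynomial_function f"
      "S = {x. (\<forall>f\<in>F. f x = 0) \<and> (\<forall>g\<in>G. g x > 0)}"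
    using assms(1) unfolding basic_semialgebraic_def by blast
  obtain F' G' where T: "finite F'" "finite G'" "\<forall>f \<in> F' \<union> G'. real_polynomial_function f"
      "T = {x. (\<forall>f\<in>F'. f x = 0) \<and> (\<forall>g\<in>G'. g x > 0)}"
    using assms(2) unfolding basic_semialgebraic_def by blast
  show ?thesis
    unfolding basic_semialgebraic_def using S T
    by (intro exI[of _ "F \<union> F'"] exI[of _ "G \<union> G'"]) auto
qed

lemma semialgebraic_basic: "basic_semialgebraic S \<Longrightarrow> semialgebraic S"
  unfolding semialgebraic_def by (rule exI[of _ "{S}"]) auto

lemma semialgebraic_Un:
  assumes "semialgebraic S" "semialgebraic T"
  shows "semialgebraic (S \<union> T)"
proof -
  obtain C D where "finite C" "\<forall>T\<in>C. basic_semialgebraic T" "S = \<Union>C"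
    "finite D" "\<forall>T\<in>D. basic_semialgebraic T" "T = \<Union>D"
    using assms unfolding semialgebraic_def by metis
  then show ?thesis
    unfolding semialgebraic_def by (intro exI[of _ "C \<union> D"]) auto
qed

lemma semialgebraic_Int:
  assumes "semialgebraic S" "semialgebraic T"
  shows "semialgebraic (S \<inter> T)"
proof -
  obtain C D where C: "finite C" "\<forall>T\<in>C. basic_semialgebraic T" "S = \<Union>C"
    and D: "finite D" "\<forall>T\<in>D. basic_semialgebraic T" "T = \<Union>D"
    using assms unfolding semialgebraic_def by metis
  show ?thesis
    unfolding semialgebraic_def
  proof (intro exI[of _ "(\<lambda>(U, V). U \<inter> V) ` (C \<times> D)"] conjI)
    show "\<forall>T\<in>(\<lambda>(U, V). U \<inter> V) ` (C \<times> D). basic_semialgebraic T"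
      using C D by (auto intro: basic_semialgebraic_Int)
  qed (use C D in auto)
qed

lemma semialgebraic_pos: "real_polynomial_function f \<Longrightarrow> semialgebraic {x. f x > 0}"
  by (rule semialgebraic_basic, unfold basic_semialgebraic_def,
      intro exI[of _ "{}"] exI[of _ "{f}"]) auto

lemma semialgebraic_zero:
  "finite F \<Longrightarrow> \<forall>f\<in>F. real_polynomial_function f \<Longrightarrow> semialgebraic {x. \<forall>f\<in>F. f x = 0}"
  by (rule semialgebraic_basic, unfold basic_semialgebraic_def,
      intro exI[of _ F] exI[of _ "{}"]) auto

text \<open>For \<open>a > 0\<close> the square is completed after multiplying by \<open>a\<close>:
  the product is \<open>(a * t + L)\<^sup>2 + (a * R - L\<^sup>2)\<close>, with minimum at
  \<open>t = - L / a\<close>. For \<open>a = 0\<close> a nonzero slope gives negative values, and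
  for \<open>a < 0\<close> the leading term dominates.\<close>

lemma quadratic_nonneg_all_iff:
  fixes a L R :: real
  shows "(\<forall>t. a * t\<^sup>2 + 2 * t * L + R \<ge> 0) \<longleftrightarrow> a > 0 \<and> a * R - L\<^sup>2 \<ge> 0 \<or> a = 0 \<and> L = 0 \<and> R \<ge> 0"
proof
  assume *: "\<forall>t. a * t\<^sup>2 + 2 * t * L + R \<ge> 0"
  have R: "R \<ge> 0"
    using spec[OF *, of 0] by simp
  consider "a > 0" | "a = 0" | "a < 0"
    by linarith
  then show "a > 0 \<and> a * R - L\<^sup>2 \<ge> 0 \<or> a = 0 \<and> L = 0 \<and> R \<ge> 0"
  proof cases
    case 1
    have "a * (a * (L / a)\<^sup>2 - 2 * (L / a) * L + R) \<ge> 0"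
      using spec[OF *, of "- L / a"] 1 by simp
    also have "a * (a * (L / a)\<^sup>2 - 2 * (L / a) * L + R) = a * R - L\<^sup>2"
      using 1 by (simp add: power2_eq_square field_simps)
    finally show ?thesis
      using 1 by simp
  next
    case 2
    have "L = 0"
    proof (rule ccontr)
      assume "L \<noteq> 0"
      \<comment> \<open>At this \<open>t\<close> the value is
        \<open>-(R + 1) + R = -1\<close>.\<close>
      then show False
        using spec[OF *, of "- (R + 1) / (2 * L)"] 2 by (simp add: field_simps)
    qed
    then show ?thesis
      using 2 R by simp
  next
    case 3
    \<comment> \<open>Large enough that \<open>- a * t\<close> exceeds
      \<open>2 * \<bar>L\<bar> + R + 1\<close>; the summand 1 gives \<open>t \<ge> 1\<close>, so
      multiplying by \<open>t\<close> still dominates the constant \<open>R\<close>.\<close>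
    define t where "t = (2 * \<bar>L\<bar> + R + 1) / (- a) + 1"
    have t: "t \<ge> 1" "(- a) * t \<ge> 2 * \<bar>L\<bar> + R + 1"
      using 3 R by (auto simp: t_def field_simps)
    have "(- a) * t * t \<ge> (2 * \<bar>L\<bar> + R + 1) * t"
      using t by (intro mult_right_mono) auto
    moreover have "L * t \<le> \<bar>L\<bar> * t" "(R + 1) * t \<ge> R + 1"
      using t R by (auto intro: mult_right_mono simp: mult_le_cancel_left1)
    ultimately have "a * t\<^sup>2 + 2 * t * L + R < 0"
      by (simp add: power2_eq_square algebra_simps)
    then show ?thesis
      using spec[OF *, of t] by simp
  qed
next
  assume *: "a > 0 \<and> a * R - L\<^sup>2 \<ge> 0 \<or> a = 0 \<and> L = 0 \<and> R \<ge> 0"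
  show "\<forall>t. a * t\<^sup>2 + 2 * t * L + R \<ge> 0"
  proof
    fix t
    consider "a > 0" "a * R - L\<^sup>2 \<ge> 0" | "a = 0" "L = 0" "R \<ge> 0"
      using * by blast
    then show "a * t\<^sup>2 + 2 * t * L + R \<ge> 0"
    proof cases
      case 1
      have "a * (a * t\<^sup>2 + 2 * t * L + R) = (a * t + L)\<^sup>2 + (a * R - L\<^sup>2)"
        by (simp add: power2_eq_square algebra_simps)
      also have "\<dots> \<ge> 0"
        using 1 by simp
      finally show ?thesis
        using 1 by (simp add: zero_le_mult_iff)
    qed auto
  qed
qed

text \<open>With the other coefficients fixed, the form is a quadratic polynomial in
  \<open>c k\<close> with leading coefficient \<open>q k k\<close>. The discriminant condition is
  semidefiniteness of the Schur complement multiplied by the pivot \<open>q k k\<close>, so no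
  division occurs; a zero pivot forces its whole row to vanish.\<close>

lemma psd_insert_iff:
  fixes q :: "'i \<Rightarrow> 'i \<Rightarrow> real"
  assumes "finite I" "k \<notin> I" and sym: "\<And>i j. q i j = q j i"
  shows "(\<forall>c. (\<Sum>i\<in>insert k I. \<Sum>j\<in>insert k I. c i * c j * q i j) \<ge> 0) \<longleftrightarrow>
    q k k > 0 \<and> (\<forall>c. (\<Sum>i\<in>I. \<Sum>j\<in>I. c i * c j * (q k k * q i j - q i k * q k j)) \<ge> 0)
    \<or> q k k = 0 \<and> (\<forall>i\<in>I. q i k = 0) \<and> (\<forall>c. (\<Sum>i\<in>I. \<Sum>j\<in>I. c i * c j * q i j) \<ge> 0)"
    (is "?lhs \<longleftrightarrow> ?rhs")
proof -
  define L where "L = (\<lambda>c. \<Sum>i\<in>I. c i * q i k)"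
  define R where "R = (\<lambda>c. \<Sum>i\<in>I. \<Sum>j\<in>I. c i * c j * q i j)"
  have expand: "(\<Sum>i\<in>insert k I. \<Sum>j\<in>insert k I. c i * c j * q i j)
      = q k k * (c k)\<^sup>2 + 2 * c k * L c + R c" for c
  proof -
    have "(\<Sum>i\<in>insert k I. \<Sum>j\<in>insert k I. c i * c j * q i j)
      = c k * c k * q k k + (\<Sum>j\<in>I. c k * c j * q k j) + ((\<Sum>i\<in>I. c i * c k * q i k) + R c)"
      using assms(1,2) by (simp add: sum.distrib R_def)
    moreover have "(\<Sum>j\<in>I. c k * c j * q k j) = c k * L c"
      unfolding L_def sum_distrib_left by (intro sum.cong refl) (subst sym, simp)
    moreover have "(\<Sum>i\<in>I. c i * c k * q i k) = c k * L c"
      unfolding L_def sum_distrib_left by (intro sum.cong refl) simp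
    ultimately show ?thesis
      by (simp add: power2_eq_square)
  qed
  have schur: "(\<Sum>i\<in>I. \<Sum>j\<in>I. c i * c j * (q k k * q i j - q i k * q k j)) = q k k * R c - (L c)\<^sup>2" for c
  proof -
    have "(L c)\<^sup>2 = (\<Sum>i\<in>I. \<Sum>j\<in>I. c i * c j * (q i k * q k j))"
      unfolding L_def power2_eq_square sum_product by (intro sum.cong refl) (subst (2) sym, simp)
    moreover have "q k k * R c = (\<Sum>i\<in>I. \<Sum>j\<in>I. c i * c j * (q k k * q i j))"
      unfolding R_def sum_distrib_left by (intro sum.cong refl) simp
    ultimately show ?thesis
      by (simp add: right_diff_distrib sum_subtractf)
  qed
  have LR_upd: "L (c(k := t)) = L c" "R (c(k := t)) = R c" for c t
    unfolding L_def R_def using assms(2) by (auto intro!: sum.cong)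
  have "?lhs \<longleftrightarrow> (\<forall>c t. q k k * t\<^sup>2 + 2 * t * L c + R c \<ge> 0)"
    unfolding expand
  proof safe
    fix c t assume "\<forall>c. 0 \<le> q k k * (c k)\<^sup>2 + 2 * c k * L c + R c"
    \<comment> \<open>\<open>L\<close> and \<open>R\<close> ignore \<open>c k\<close>, which can
      therefore be set to any \<open>t\<close>.\<close>
    from spec[OF this, of "c(k := t)"] show "q k k * t\<^sup>2 + 2 * t * L c + R c \<ge> 0"
      by (simp add: LR_upd)
  qed auto
  also have "\<dots> \<longleftrightarrow> (\<forall>c. q k k > 0 \<and> q k k * R c - (L c)\<^sup>2 \<ge> 0 \<or> q k k = 0 \<and> L c = 0 \<and> R c \<ge> 0)"
    by (simp add: quadratic_nonneg_all_iff)
  \<comment> \<open>The sign of \<open>q k k\<close> does not depend on \<open>c\<close>, so the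
    quantifier passes into the two disjuncts.\<close>
  also have "\<dots> \<longleftrightarrow> q k k > 0 \<and> (\<forall>c. q k k * R c - (L c)\<^sup>2 \<ge> 0) \<or> q k k = 0 \<and> (\<forall>c. L c = 0) \<and> (\<forall>c. R c \<ge> 0)"
    by auto
  also have "(\<forall>c. L c = 0) \<longleftrightarrow> (\<forall>i\<in>I. q i k = 0)"
  proof safe
    fix i assume "\<forall>c. L c = 0" and i: "i \<in> I"
    then have "L (\<lambda>j. if j = i then 1 else 0) = 0"
      by blast
    then show "q i k = 0"
      using i assms(1) by (simp add: L_def if_distrib[where f = "\<lambda>x. x * _"] cong: if_cong)
  qed (simp add: L_def)
  finally show ?thesis
    unfolding schur by (simp add: R_def)
qed

text \<open>Each induction step splits on whether the pivot is positive or zero. In the first case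
  the new entries are 2 by 2 minors, again polynomial and symmetric; this is why \<open>q\<close>
  varies in the induction.\<close>

lemma semialgebraic_psd:
  fixes q :: "'i \<Rightarrow> 'i \<Rightarrow> 'a::euclidean_space \<Rightarrow> real"
  assumes "finite I" "\<And>i j. real_polynomial_function (q i j)" "\<And>i j x. q i j x = q j i x"
  shows "semialgebraic {x. \<forall>c. (\<Sum>i\<in>I. \<Sum>j\<in>I. c i * c j * q i j x) \<ge> 0}"
  using assms
proof (induction I arbitrary: q rule: finite_induct)
  case empty
  then show ?case
    using semialgebraic_zero[of "{}"] by simp
next
  case (insert k I)
  have eq: "{x. \<forall>c. (\<Sum>i\<in>insert k I. \<Sum>j\<in>insert k I. c i * c j * q i j x) \<ge> 0} =
     ({x. q k k x > 0} \<inter> {x. \<forall>c. (\<Sum>i\<in>I. \<Sum>j\<in>I. c i * c j * (q k k x * q i j x - q i k x * q k j x)) \<ge> 0})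
     \<union> ({x. \<forall>f\<in>insert (q k k) ((\<lambda>i. q i k) ` I). f x = 0} \<inter> {x. \<forall>c. (\<Sum>i\<in>I. \<Sum>j\<in>I. c i * c j * q i j x) \<ge> 0})"
    using insert.hyps insert.prems(2) by (subst psd_insert_iff) auto
  have "semialgebraic {x. \<forall>c. (\<Sum>i\<in>I. \<Sum>j\<in>I. c i * c j * (q k k x * q i j x - q i k x * q k j x)) \<ge> 0}"
  proof (rule insert.IH)
    show "real_polynomial_function (\<lambda>x. q k k x * q i j x - q i k x * q k j x)" for i j
      using insert.prems(1) by (intro real_polynomial_function_diff real_polynomial_function.intros(4))
    show "q k k x * q i j x - q i k x * q k j x = q k k x * q j i x - q j k x * q k i x" for i j x
      using insert.prems(2)[of i k x] insert.prems(2)[of k j x] insert.prems(2)[of i j x] by simp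
  qed
  moreover have "semialgebraic {x. \<forall>c. (\<Sum>i\<in>I. \<Sum>j\<in>I. c i * c j * q i j x) \<ge> 0}"
    using insert.prems by (rule insert.IH)
  ultimately show ?case
    unfolding eq using insert.hyps(1) insert.prems(1)
    by (intro semialgebraic_Un semialgebraic_Int semialgebraic_pos semialgebraic_zero) auto
qed

text \<open>For each fixed \<open>c\<close> this is a weak inequality between continuous functions,
  and closed sets are intersected over all \<open>c\<close>.\<close>

lemma closed_psd:
  fixes q :: "'i \<Rightarrow> 'i \<Rightarrow> 'a::euclidean_space \<Rightarrow> real"
  assumes "\<And>i j. real_polynomial_function (q i j)"
  shows "closed {x. \<forall>c. (\<Sum>i\<in>I. \<Sum>j\<in>I. c i * c j * q i j x) \<ge> 0}"
proof (intro closed_Collect_all closed_Collect_le continuous_intros)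
  show "continuous_on UNIV (q i j)" for i j
    using continuous_real_polymonial_function[OF assms]
    by (simp add: continuous_at_imp_continuous_on)
qed

section \<open>Quaternion-valued polynomial maps\<close>

definition quat_polynomial :: "('a::euclidean_space \<Rightarrow> quat) \<Rightarrow> bool" where
  "quat_polynomial f \<longleftrightarrow> real_polynomial_function (\<lambda>x. Re_q (f x)) \<and> real_polynomial_function (\<lambda>x. Im_i (f x))
    \<and> real_polynomial_function (\<lambda>x. Im_j (f x)) \<and> real_polynomial_function (\<lambda>x. Im_k (f x))"

lemma quat_components_sum [simp]:
  "Re_q (sum f S) = (\<Sum>i\<in>S. Re_q (f i))" "Im_i (sum f S) = (\<Sum>i\<in>S. Im_i (f i))"
  "Im_j (sum f S) = (\<Sum>i\<in>S. Im_j (f i))" "Im_k (sum f S) = (\<Sum>i\<in>S. Im_k (f i))"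
  by (induction S rule: infinite_finite_induct, simp_all)+

lemma quat_polynomial_diff: "quat_polynomial f \<Longrightarrow> quat_polynomial g \<Longrightarrow> quat_polynomial (\<lambda>x. f x - g x)"
  unfolding quat_polynomial_def by (auto intro: real_polynomial_function_diff)

lemma quat_polynomial_sum:
  "finite S \<Longrightarrow> (\<And>i. i \<in> S \<Longrightarrow> quat_polynomial (f i)) \<Longrightarrow> quat_polynomial (\<lambda>x. \<Sum>i\<in>S. f i x)"
  unfolding quat_polynomial_def by (auto intro: real_polynomial_function_sum)

lemma quat_polynomial_mult:
  "quat_polynomial f \<Longrightarrow> quat_polynomial g \<Longrightarrow> quat_polynomial (\<lambda>x. f x * g x)"
  unfolding quat_polynomial_def
  by (simp add: real_polynomial_function_diff real_polynomial_function.intros)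

lemma bounded_linear_quat_components:
  "bounded_linear Re_q" "bounded_linear Im_i" "bounded_linear Im_j" "bounded_linear Im_k"
  by (rule linear_conv_bounded_linear[THEN iffD1], rule linearI, simp, simp)+

lemma quat_polynomial_bounded_linear: "bounded_linear f \<Longrightarrow> quat_polynomial f"
  unfolding quat_polynomial_def
  by (auto intro!: real_polynomial_function.intros(1) bounded_linear_compose[OF bounded_linear_quat_components(1)]
      bounded_linear_compose[OF bounded_linear_quat_components(2)]
      bounded_linear_compose[OF bounded_linear_quat_components(3)]
      bounded_linear_compose[OF bounded_linear_quat_components(4)])

lemma quat_polynomial_const: "quat_polynomial (\<lambda>_. c)"
  unfolding quat_polynomial_def by (simp add: real_polynomial_function.intros(2))

section \<open>The algebra of quaternionic matrices and its trace\<close>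

text \<open>On this copy of the matrix type the matrix product is the ring multiplication, so powers
  and the facts about real algebras apply.\<close>

typedef ('n::finite) qmat = "UNIV :: (quat^'n^'n) set"
  morphisms mat_of qmat ..

setup_lifting type_definition_qmat

instantiation qmat :: (finite) real_algebra_1
begin

lift_definition zero_qmat :: "'a qmat" is 0 .
lift_definition one_qmat :: "'a qmat" is "mat 1" .
lift_definition plus_qmat :: "'a qmat \<Rightarrow> 'a qmat \<Rightarrow> 'a qmat" is "(+)" .
lift_definition minus_qmat :: "'a qmat \<Rightarrow> 'a qmat \<Rightarrow> 'a qmat" is "(-)" .
lift_definition uminus_qmat :: "'a qmat \<Rightarrow> 'a qmat" is uminus .
lift_definition times_qmat :: "'a qmat \<Rightarrow> 'a qmat \<Rightarrow> 'a qmat" is "(**)" .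
lift_definition scaleR_qmat :: "real \<Rightarrow> 'a qmat \<Rightarrow> 'a qmat" is scaleR .

instance
proof
  fix a b c :: "'a qmat" and r s :: real
  show "a + b + c = a + (b + c)" "a + b = b + a" "0 + a = a" "- a + a = 0" "a - b = a + - b"
    by (transfer; simp)+
  show "a * b * c = a * (b * c)"
    by transfer (simp add: matrix_mul_assoc)
  show "1 * a = a" "a * 1 = a"
    by (transfer; simp)+
  show "(a + b) * c = a * c + b * c" "a * (b + c) = a * b + a * c"
    by (transfer; simp add: vec_eq_iff matrix_matrix_mult_def sum.distrib algebra_simps)+
  show "(0 :: 'a qmat) \<noteq> 1"
    by transfer (simp add: vec_eq_iff mat_def)
  show "r *\<^sub>R (a + b) = r *\<^sub>R a + r *\<^sub>R b" "(r + s) *\<^sub>R a = r *\<^sub>R a + s *\<^sub>R a"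
    "r *\<^sub>R s *\<^sub>R a = (r * s) *\<^sub>R a" "1 *\<^sub>R a = a"
    by (transfer; simp add: algebra_simps)+
  show "r *\<^sub>R a * b = r *\<^sub>R (a * b)" "a * r *\<^sub>R b = r *\<^sub>R (a * b)"
    by (transfer; simp add: vec_eq_iff matrix_matrix_mult_def scaleR_sum_right)+
qed

end

lift_definition act :: "'n::finite qmat \<Rightarrow> quat^'n \<Rightarrow> quat^'n" is "(*v)" .

lemma act_simps [simp]:
  "act (x * y) v = act x (act y v)" "act 1 v = v" "act 0 v = 0" "act x 0 = 0"
  "act (x + y) v = act x v + act y v" "act (x - y) v = act x v - act y v" "act (- x) v = - act x v"
  "act (r *\<^sub>R x) v = r *\<^sub>R act x v" "act x (v + w) = act x v + act x w"
  "act x (v - w) = act x v - act x w" "act x (- v) = - act x v" "act x (r *\<^sub>R v) = r *\<^sub>R act x v"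
proof -
  show mult: "act (x * y) v = act x (act y v)"
    by transfer (simp add: matrix_vector_mul_assoc)
  show "act 1 v = v" "act 0 v = 0" "act x 0 = 0"
    by (transfer; simp)+
  show "act (x + y) v = act x v + act y v" "act (x - y) v = act x v - act y v"
    "act x (v + w) = act x v + act x w" "act x (v - w) = act x v - act x w"
    by (transfer; simp add: matrix_vector_mult_add_rdistrib matrix_vector_mult_diff_rdistrib
        matrix_vector_mult_diff_distrib matrix_vector_right_distrib)+
  show "act (- x) v = - act x v" "act x (- v) = - act x v" "act (r *\<^sub>R x) v = r *\<^sub>R act x v"
    "act x (r *\<^sub>R v) = r *\<^sub>R act x v"
    by (transfer; simp add: vec_eq_iff matrix_vector_mult_def scaleR_sum_right sum_negf)+
qed

lemma act_eqI: "(\<And>v. act x v = act y v) \<Longrightarrow> x = y"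
proof (transfer)
  fix x y :: "quat^'a^'a" assume *: "\<And>v. x *v v = y *v v"
  have "x $ i $ j = y $ i $ j" for i j
    using arg_cong[OF *[of "axis j 1"], of "\<lambda>v. v $ i"]
    by (simp add: matrix_vector_mult_def axis_def if_distrib cong: if_cong)
  then show "x = y"
    by (simp add: vec_eq_iff)
qed

lemma linear_act [simp]: "linear (act x)"
  by (rule linearI) simp_all

text \<open>Column vectors form a right vector space over the quaternions; matrices act on it from the left.\<close>

definition rscale :: "quat^'n \<Rightarrow> quat \<Rightarrow> quat^'n" (infixl "\<bullet>\<^sub>q" 75) where
  "v \<bullet>\<^sub>q c = (\<chi> i. v $ i * c)"

lemma rscale_simps [simp]:
  "(v + w) \<bullet>\<^sub>q c = v \<bullet>\<^sub>q c + w \<bullet>\<^sub>q c" "(v - w) \<bullet>\<^sub>q c = v \<bullet>\<^sub>q c - w \<bullet>\<^sub>q c" "(- v) \<bullet>\<^sub>q c = - (v \<bullet>\<^sub>q c)"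
  "v \<bullet>\<^sub>q (c + d) = v \<bullet>\<^sub>q c + v \<bullet>\<^sub>q d" "v \<bullet>\<^sub>q (c - d) = v \<bullet>\<^sub>q c - v \<bullet>\<^sub>q d" "v \<bullet>\<^sub>q (- c) = - (v \<bullet>\<^sub>q c)"
  "v \<bullet>\<^sub>q 1 = v" "v \<bullet>\<^sub>q 0 = 0" "0 \<bullet>\<^sub>q c = 0" "v \<bullet>\<^sub>q c \<bullet>\<^sub>q d = v \<bullet>\<^sub>q (c * d)"
  "(r *\<^sub>R v) \<bullet>\<^sub>q c = r *\<^sub>R (v \<bullet>\<^sub>q c)" "v \<bullet>\<^sub>q (r *\<^sub>R c) = r *\<^sub>R (v \<bullet>\<^sub>q c)"
  by (simp_all add: rscale_def vec_eq_iff algebra_simps)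

lemma act_rscale [simp]: "act x (v \<bullet>\<^sub>q c) = act x v \<bullet>\<^sub>q c"
  by (simp add: rscale_def act.rep_eq vec_eq_iff matrix_vector_mult_def sum_distrib_right mult.assoc)

lemma rscale_of_real: "v \<bullet>\<^sub>q of_real r = r *\<^sub>R v"
  by (simp add: of_real_def)

definition quat_subspace :: "(quat^'n) set \<Rightarrow> bool" where
  "quat_subspace S \<longleftrightarrow> 0 \<in> S \<and> (\<forall>v\<in>S. \<forall>w\<in>S. v + w \<in> S) \<and> (\<forall>v\<in>S. \<forall>c. v \<bullet>\<^sub>q c \<in> S)"

lemma quat_subspace_subspace: "quat_subspace S \<Longrightarrow> subspace S"
  unfolding quat_subspace_def subspace_def by (metis rscale_of_real)

section \<open>The trace of idempotent and nilpotent operators\<close>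

definition linear_trace :: "('a::euclidean_space \<Rightarrow> 'a) \<Rightarrow> real" where
  "linear_trace f = (\<Sum>b\<in>Basis. f b \<bullet> b)"

lemma linear_trace_comp_commute:
  fixes f g :: "'a::euclidean_space \<Rightarrow> 'a"
  assumes "linear f" "linear g"
  shows "linear_trace (f \<circ> g) = linear_trace (g \<circ> f)"
proof -
  have *: "linear_trace (f \<circ> g) = (\<Sum>b\<in>Basis. \<Sum>c\<in>Basis. (g b \<bullet> c) * (f c \<bullet> b))"
    if "linear f" for f g :: "'a \<Rightarrow> 'a"
  proof -
    have "f (g b) = (\<Sum>c\<in>Basis. (g b \<bullet> c) *\<^sub>R f c)" for b
      by (subst euclidean_representation[symmetric, of "g b"])
        (simp only: linear_sum[OF that] linear_scale[OF that])
    then show ?thesis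
      by (simp add: linear_trace_def inner_sum_left)
  qed
  show ?thesis
    unfolding *[OF assms(1), of g] *[OF assms(2), of f] by (subst sum.swap) (simp add: mult.commute)
qed

text \<open>The trace is the sum of \<open>(c \<bullet> b)\<^sup>2\<close> over an orthonormal basis
  of \<open>W\<close> and the standard basis; summing over \<open>b\<close> first gives 1 for each
  \<open>c\<close>.\<close>

lemma orthogonal_projection_exists:
  fixes W :: "'a::euclidean_space set"
  assumes "subspace W"
  obtains p where "linear p" "\<And>v. p v \<in> W" "\<And>v. v \<in> W \<Longrightarrow> p v = v" "linear_trace p = real (dim W)"
proof -
  obtain B where B: "B \<subseteq> W" "pairwise orthogonal B" "\<And>x. x \<in> B \<Longrightarrow> norm x = 1"
      "independent B" "card B = dim W" "span B = W"
    using orthonormal_basis_subspace[OF assms] by metis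
  have fin: "finite B"
    using B(4) independent_imp_finite by blast
  define p where "p = (\<lambda>v. \<Sum>i\<in>B. (v \<bullet> i) *\<^sub>R i)"
  have "linear p"
    unfolding p_def
    by (rule linearI) (simp_all add: inner_left_distrib scaleR_left_distrib sum.distrib scaleR_sum_right)
  moreover have "p v \<in> W" for v
    unfolding p_def using B assms by (intro subspace_sum subspace_scale) auto
  moreover have "p v = v" if "v \<in> W" for v
    unfolding p_def using orthonormal_basis_expand[OF B(2,3)] that B(6) fin by blast
  moreover have "linear_trace p = real (dim W)"
  proof -
    have "linear_trace p = (\<Sum>c\<in>B. \<Sum>b\<in>Basis. (c \<bullet> b) * (c \<bullet> b))"
      unfolding linear_trace_def p_def inner_sum_left
      by (subst sum.swap) (simp add: inner_commute)
    also have "\<dots> = (\<Sum>c\<in>B. c \<bullet> c)"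
      by (simp add: euclidean_inner[symmetric])
    also have "\<dots> = (\<Sum>c\<in>B. 1)"
      using B(3) by (intro sum.cong refl) (simp add: norm_eq_1)
    finally show ?thesis
      using B(5) by simp
  qed
  ultimately show ?thesis
    using that by blast
qed

text \<open>If \<open>p\<close> is the orthogonal projection onto the image of \<open>e\<close>,
  then \<open>p \<circ> e = e\<close> and \<open>e \<circ> p = p\<close>, so both have the same
  trace.\<close>

lemma linear_trace_idempotent:
  fixes e :: "'a::euclidean_space \<Rightarrow> 'a"
  assumes "linear e" "\<And>v. e (e v) = e v"
  shows "linear_trace e = real (dim (range e))"
proof -
  obtain p where p: "linear p" "\<And>v. p v \<in> range e" "\<And>v. v \<in> range e \<Longrightarrow> p v = v"
    "linear_trace p = real (dim (range e))"
    using orthogonal_projection_exists[OF linear_subspace_image[OF assms(1) subspace_UNIV]] by metis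
  have "p \<circ> e = e"
    using p(3) by (auto simp: fun_eq_iff)
  moreover have "e (p v) = p v" for v
    using p(2)[of v] assms(2) by auto
  then have "e \<circ> p = p"
    by (simp add: fun_eq_iff)
  ultimately show ?thesis
    using linear_trace_comp_commute[OF p(1) assms(1)] p(4) by simp
qed

lemma linear_trace_nilpotent_on:
  fixes f p :: "'a::euclidean_space \<Rightarrow> 'a"
  assumes "linear f" "subspace W" "f ` W \<subseteq> W" "\<And>v. v \<in> W \<Longrightarrow> (f ^^ m) v = 0"
    and "linear p" "\<And>v. p v \<in> W" "\<And>v. v \<in> W \<Longrightarrow> p v = v"
  shows "linear_trace (f \<circ> p) = 0"
  using assms
proof (induction m arbitrary: W p)
  case 0
  then have "p = (\<lambda>v. 0)"
    by auto
  then show ?case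
    using linear_0[OF \<open>linear f\<close>] by (simp add: linear_trace_def)
next
  case (Suc m)
  have sub: "subspace (f ` W)"
    using Suc.prems by (simp add: linear_subspace_image)
  obtain p' where p': "linear p'" "\<And>v. p' v \<in> f ` W" "\<And>v. v \<in> f ` W \<Longrightarrow> p' v = v"
    using orthogonal_projection_exists[OF sub] by metis
  have "f \<circ> p = p' \<circ> (f \<circ> p)"
    using Suc.prems p' by (auto simp: fun_eq_iff)
  then have "linear_trace (f \<circ> p) = linear_trace ((f \<circ> p) \<circ> p')"
    by (metis linear_trace_comp_commute linear_compose Suc.prems(1,5) p'(1))
  also have "(f \<circ> p) \<circ> p' = f \<circ> p'"
    using Suc.prems p'(2) by (auto simp: fun_eq_iff subset_iff)
  also have "linear_trace (f \<circ> p') = 0"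
  proof (rule Suc.IH)
    show "(f ^^ m) v = 0" if "v \<in> f ` W" for v
      using that Suc.prems(4) by (auto simp: funpow_swap1)
  qed (use Suc.prems p' sub in auto)
  finally show ?case .
qed

lemma linear_trace_nilpotent:
  fixes f :: "'a::euclidean_space \<Rightarrow> 'a"
  assumes "linear f" "\<And>v. (f ^^ m) v = 0"
  shows "linear_trace f = 0"
  using linear_trace_nilpotent_on[OF assms(1) subspace_UNIV, of m id] assms(2)
  by (simp add: linear_id[unfolded id_def] id_def o_def)

definition trace_re :: "'n::finite qmat \<Rightarrow> real" where
  "trace_re x = (\<Sum>i\<in>UNIV. Re_q (mat_of x $ i $ i))"

text \<open>A diagonal entry \<open>q\<close> contributes the inner products of \<open>q * u\<close>
  with \<open>u\<close> for the four units \<open>u\<close>, each equal to \<open>Re_q q\<close>.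
  The properties of operator traces thereby pass to \<open>trace_re\<close>.\<close>

lemma linear_trace_act: "linear_trace (act x) = 4 * trace_re x"
proof -
  have "bij_betw (\<lambda>(i, u). axis i u) (UNIV \<times> Basis) (Basis :: (quat^'a) set)"
    by (auto simp: bij_betw_def inj_on_def axis_eq_axis Basis_vec_def)
  from sum.reindex_bij_betw[OF this, of "\<lambda>b. act x b \<bullet> b"]
  have "linear_trace (act x) = (\<Sum>i\<in>UNIV. \<Sum>u\<in>Basis. act x (axis i u) \<bullet> axis i u)"
    by (simp add: linear_trace_def sum.cartesian_product case_prod_unfold)
  also have "\<dots> = (\<Sum>i\<in>UNIV. \<Sum>u\<in>Basis. (mat_of x $ i $ i * u) \<bullet> u)"
    unfolding inner_axis by (simp add: act.rep_eq matrix_vector_mult_def axis_def if_distrib cong: if_cong)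
  also have "\<dots> = (\<Sum>i\<in>UNIV. 4 * Re_q (mat_of x $ i $ i))"
    by (intro sum.cong refl) (simp add: Basis_quat_def inner_quat_def quat_eq_iff)
  finally show ?thesis
    by (simp add: trace_re_def sum_distrib_left)
qed

lemma trace_re_simps [simp]:
  "trace_re (x + y) = trace_re x + trace_re y" "trace_re (x - y) = trace_re x - trace_re y"
  "trace_re (r *\<^sub>R x) = r * trace_re x" "trace_re 0 = 0"
  by (simp_all add: trace_re_def plus_qmat.rep_eq minus_qmat.rep_eq scaleR_qmat.rep_eq
      zero_qmat.rep_eq sum.distrib sum_subtractf sum_distrib_left)

lemma act_times: "act (x * y) = act x \<circ> act y"
  by (simp add: fun_eq_iff)

lemma act_power: "act (x ^ k) v = (act x ^^ k) v"
  by (induction k) auto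

lemma trace_re_commute: "trace_re (x * y) = trace_re (y * x)"
  using linear_trace_comp_commute[of "act x" "act y"]
  by (simp add: act_times[symmetric] linear_trace_act)

lemma trace_re_idempotent_pos:
  assumes "e * e = e" "e \<noteq> 0"
  shows "trace_re e > 0"
proof -
  have "act e (act e v) = act e v" for v
    using assms(1) by (metis act_simps(1))
  then have "4 * trace_re e = real (dim (range (act e)))"
    unfolding linear_trace_act[symmetric] by (intro linear_trace_idempotent) auto
  moreover have "dim (range (act e)) \<noteq> 0"
  proof
    assume "dim (range (act e)) = 0"
    then have "act e v = act 0 v" for v
      by (auto simp: dim_eq_0)
    then show False
      using assms(2) act_eqI by blast
  qed
  ultimately show ?thesis
    by linarith
qed

lemma trace_re_nilpotent:
  assumes "x ^ m = 0"
  shows "trace_re x = 0"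
  using linear_trace_nilpotent[of "act x" m] assms
  by (simp add: linear_trace_act act_power[symmetric])

section \<open>Nilpotent elements of a trace-negative algebra\<close>

lemma decreasing_subspaces_stabilize:
  fixes S :: "nat \<Rightarrow> 'a::euclidean_space set"
  assumes "\<And>k. subspace (S k)" "decseq S"
  shows "\<exists>k. \<forall>m\<ge>k. S m = S k"
proof -
  obtain k where k: "\<And>m. dim (S k) \<le> dim (S m)"
    using ex_has_least_nat[of "\<lambda>_. True" 0 "\<lambda>k. dim (S k)"] by auto
  have "S m = S k" if "m \<ge> k" for m
    using assms k[of m] that by (intro subspace_dim_equal) (auto simp: decseq_def)
  then show ?thesis
    by blast
qed

locale qmat_algebra =
  fixes \<A> :: "'n::finite qmat set"
  assumes subspace: "subspace \<A>"
    and one_in: "1 \<in> \<A>"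
    and mult_in: "x \<in> \<A> \<Longrightarrow> y \<in> \<A> \<Longrightarrow> x * y \<in> \<A>"
begin

lemma in_simps: "0 \<in> \<A>" "x \<in> \<A> \<Longrightarrow> y \<in> \<A> \<Longrightarrow> x + y \<in> \<A>" "x \<in> \<A> \<Longrightarrow> y \<in> \<A> \<Longrightarrow> x - y \<in> \<A>"
  "x \<in> \<A> \<Longrightarrow> - x \<in> \<A>" "x \<in> \<A> \<Longrightarrow> r *\<^sub>R x \<in> \<A>"
  using subspace by (auto intro: subspace_0 subspace_add subspace_diff subspace_neg subspace_scale)

lemma power_in: "x \<in> \<A> \<Longrightarrow> x ^ k \<in> \<A>"
  by (induction k) (auto intro: one_in mult_in)

lemmas closed = in_simps one_in mult_in power_in

text \<open>The Fitting decomposition: \<open>e\<close> is a polynomial in \<open>w\<close>, and \<open>w\<close> is invertible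
  on the image of \<open>e\<close> and nilpotent on its kernel.\<close>

lemma fitting_idempotent:
  assumes w: "w \<in> \<A>"
  obtains s k where "s \<in> \<A>" "s * w = w * s" "(w * s) * (w * s) = w * s"
    "w * s * w ^ k = w ^ k" "(w * (1 - w * s)) ^ k = 0"
proof -
  define C where "C = span (range (\<lambda>i. w ^ i))"
  define S where "S = (\<lambda>k. (\<lambda>s. w ^ k * s) ` C)"
  have C_le: "C \<subseteq> \<A>"
    unfolding C_def using w by (intro span_minimal subspace) (auto intro: closed)
  have w_C: "w * s \<in> C" if "s \<in> C" for s
  proof -
    have "(*) w ` C \<subseteq> C"
      unfolding C_def by (subst linear_span_image[symmetric])
        (auto intro!: linearI span_mono simp: algebra_simps simp flip: power_Suc)
    then show ?thesis
      using that by auto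
  qed
  have commute: "s * w = w * s" if "s \<in> C" for s
  proof -
    have "C \<subseteq> {s. s * w = w * s}"
      unfolding C_def
      by (intro span_minimal) (auto simp: subspace_def algebra_simps power_commutes)
    then show ?thesis
      using that by auto
  qed
  \<comment> \<open>The chain is carried by \<open>mat_of\<close> into a Euclidean space, where
    dimensions can be compared.\<close>
  have "\<exists>k. \<forall>m\<ge>k. mat_of ` S m = mat_of ` S k"
  proof (rule decreasing_subspaces_stabilize)
    fix k
    have "linear (\<lambda>s. mat_of (w ^ k * s))"
      by (rule linearI) (simp_all add: algebra_simps plus_qmat.rep_eq scaleR_qmat.rep_eq)
    then have "subspace ((\<lambda>s. mat_of (w ^ k * s)) ` C)"
      by (rule linear_subspace_image) (simp add: C_def)
    then show "subspace (mat_of ` S k)"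
      by (simp add: S_def image_image)
  next
    have "S (Suc k) \<subseteq> S k" for k
      unfolding S_def using w_C by (auto simp: power_Suc2 mult.assoc simp del: power_Suc)
    then show "decseq (\<lambda>k. mat_of ` S k)"
      by (intro decseq_SucI image_mono)
  qed
  then obtain k0 where k0: "\<And>m. m \<ge> k0 \<Longrightarrow> S m = S k0"
    by (metis inj_image_eq_iff mat_of_inject injI)
  \<comment> \<open>The successor leaves \<open>w ^ k0\<close> after one factor \<open>w\<close> is
    split off, so that \<open>w * s = w ^ k * r\<close> below. As \<open>S k = S (2 * k)\<close>,
    the element \<open>w ^ k\<close> equals \<open>w ^ (2 * k) * r\<close> with \<open>r\<close> a
    polynomial in \<open>w\<close>.\<close>
  define k where "k = Suc k0"
  have "1 \<in> C"
    unfolding C_def by (intro span_base) (auto intro: range_eqI[of _ _ 0])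
  then have "w ^ k \<in> S k"
    unfolding S_def by force
  also have "S k = S (2 * k)"
    using k0[of k] k0[of "2 * k"] by (simp add: k_def)
  finally obtain r where r: "r \<in> C" "w ^ k = w ^ (2 * k) * r"
    unfolding S_def by auto
  define s where "s = w ^ k0 * r"
  have ws: "w * s = w ^ k * r"
    by (simp add: s_def k_def mult.assoc)
  have r_comm: "r * w ^ j = w ^ j * r" for j
    using commute[OF r(1)] by (induction j) (simp_all add: mult.assoc, metis mult.assoc)
  have e_pow: "w * s * w ^ k = w ^ k"
    using r(2) r_comm[of k] by (simp add: ws mult.assoc mult_2 power_add)
  have idem: "(w * s) * (w * s) = w * s"
    using e_pow by (metis ws mult.assoc)
  have sw: "s * w = w * s"
  proof -
    have "s * w = w ^ k0 * w * r"
      using commute[OF r(1)] by (simp add: s_def mult.assoc)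
    then show ?thesis
      by (simp only: s_def power_commutes mult.assoc)
  qed
  \<comment> \<open>The factor \<open>1 - w * s\<close> is an idempotent commuting with
    \<open>w\<close>, so one copy of it survives in every positive power.\<close>
  have "(w * (1 - w * s)) ^ Suc j = w ^ Suc j * (1 - w * s)" for j
  proof (induction j)
    case (Suc j)
    have "(1 - w * s) * w = w * (1 - w * s)"
      using sw by (simp add: algebra_simps mult.assoc)
    then have "(1 - w * s) * w ^ Suc j = w ^ Suc j * (1 - w * s)"
      by (metis power_commuting_commutes)
    then have "w * (1 - w * s) * (w ^ Suc j * (1 - w * s)) = w * (w ^ Suc j) * ((1 - w * s) * (1 - w * s))"
      by (metis mult.assoc)
    also have "(1 - w * s) * (1 - w * s) = 1 - w * s"
      using idem by (simp add: algebra_simps)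
    finally show ?case
      using Suc.IH by simp
  qed simp
  then have "(w * (1 - w * s)) ^ k = w ^ k - w ^ k * (w * s)"
    by (simp add: k_def right_diff_distrib del: power_Suc)
  also have "w ^ k * (w * s) = w * s * w ^ k"
    using r_comm[of k] by (simp add: ws mult.assoc)
  finally have "(w * (1 - w * s)) ^ k = 0"
    using e_pow by simp
  moreover have "s \<in> \<A>"
    using C_le r(1) w by (auto simp: s_def intro: closed)
  ultimately show ?thesis
    using that sw idem e_pow by blast
qed

end

locale trace_negative_algebra = qmat_algebra +
  assumes trace_commutator: "x \<in> \<A> \<Longrightarrow> y \<in> \<A> \<Longrightarrow> trace_re ((x * y - y * x) * (x * y - y * x)) \<le> 0"
begin

text \<open>If \<open>x\<close> is nilpotent and \<open>x \<A>\<close> is not nil, let \<open>u = x\<^sup>m\<close> be the last power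
  with \<open>u \<A>\<close> not nil. Then \<open>e = u y\<close> is a nonzero idempotent for some \<open>y\<close>, which may be chosen
  with \<open>y e = y\<close>, and the square of \<open>[u, y]\<close> has trace
  \<open>2 tr e - 2 tr (u\<^sup>2 y\<^sup>2) = 2 tr e > 0\<close>.\<close>

lemma nilpotent_mult:
  assumes x: "x \<in> \<A>" "x ^ N = 0" and y: "y \<in> \<A>"
  shows "\<exists>k. (x * y) ^ k = 0"
proof (rule ccontr)
  assume not_nil: "\<nexists>k. (x * y) ^ k = 0"
  define nilR where "nilR = (\<lambda>u. \<forall>y\<in>\<A>. \<exists>k. (u * y) ^ k = 0)"
  define M where "M = (LEAST M. nilR (x ^ M))"
  have "(0 * y) ^ 1 = 0" for y :: "'a qmat"
    by simp
  then have "nilR (x ^ N)"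
    unfolding nilR_def x(2) by blast
  then have M: "nilR (x ^ M)" "\<And>m. m < M \<Longrightarrow> \<not> nilR (x ^ m)"
    unfolding M_def
    using LeastI[of "\<lambda>M. nilR (x ^ M)" N] not_less_Least[of _ "\<lambda>M. nilR (x ^ M)"] by auto
  \<comment> \<open>Exponents 0 and 1 are excluded by \<open>1 * 1\<close> and by
    \<open>x * y\<close>, so \<open>M \<ge> 2\<close> and the previous exponent \<open>m\<close> is
    positive.\<close>
  have "\<not> nilR (x ^ 0)"
    unfolding nilR_def using one_in by (auto intro!: bexI[of _ 1])
  moreover have "\<not> nilR (x ^ 1)"
    unfolding nilR_def using y not_nil by auto
  ultimately obtain m where m: "M = Suc m" "m \<ge> 1"
    using M(1) by (metis One_nat_def Suc_le_eq neq0_conv not0_implies_Suc)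
  define u where "u = x ^ m"
  have u: "u \<in> \<A>" "\<not> nilR u"
    using x M(2)[of m] m by (auto simp: u_def intro: closed)
  \<comment> \<open>Since \<open>m \<ge> 1\<close>, the exponent \<open>2 * m\<close> is at least
    \<open>M\<close>, and \<open>u * u\<close> lies in the nil right ideal generated by
    \<open>x ^ M\<close>.\<close>
  have "u * u = x ^ (M + (m - 1))"
    using m by (simp add: u_def power_add[symmetric] del: power_Suc)
  then have uu: "u * u = x ^ M * x ^ (m - 1)"
    by (simp add: power_add)
  obtain y0 where y0: "y0 \<in> \<A>" "\<And>k. (u * y0) ^ k \<noteq> 0"
    using u(2) unfolding nilR_def by auto
  define w where "w = u * y0"
  have "w \<in> \<A>"
    using u y0 by (auto simp: w_def intro: closed)
  then obtain s k where s: "s \<in> \<A>" "(w * s) * (w * s) = w * s" "w * s * w ^ k = w ^ k"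
    using fitting_idempotent by metis
  define e where "e = w * s"
  define y' where "y' = y0 * s * e"
  \<comment> \<open>\<open>e\<close> is nonzero because \<open>e * w ^ k = w ^ k\<close> and no
    power of \<open>w\<close> vanishes.\<close>
  have e: "e * e = e" "e \<noteq> 0"
    using s y0(2)[of k] by (auto simp: e_def w_def)
  have y'_in: "y' \<in> \<A>"
    using s y0 u by (auto simp: y'_def e_def w_def intro: closed)
  have uy: "u * y' = e"
    using e(1) by (simp add: y'_def e_def w_def mult.assoc)
  have ye: "y' * e = y'"
    using e(1) by (simp add: y'_def mult.assoc)
  \<comment> \<open>Substituting \<open>e = u * y'\<close> turns the product into
    \<open>u * u * y' * y'\<close>, an element of the nil right ideal of
    \<open>x ^ M\<close>.\<close>
  have "trace_re (u * e * y') = 0"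
  proof -
    have "x ^ (m - 1) * y' * y' \<in> \<A>"
      using x y'_in by (intro closed)
    then have "\<exists>k. (x ^ M * (x ^ (m - 1) * y' * y')) ^ k = 0"
      using M(1) unfolding nilR_def by blast
    moreover have "u * e * y' = x ^ M * (x ^ (m - 1) * y' * y')"
    proof -
      have "u * e * y' = (u * u) * (y' * y')"
        unfolding uy[symmetric] by (simp only: mult.assoc)
      then show ?thesis
        by (simp only: uu mult.assoc)
    qed
    ultimately show ?thesis
      using trace_re_nilpotent by metis
  qed
  then have t0: "trace_re (e * (y' * u)) = 0" "trace_re (y' * u * e) = 0"
    using trace_re_commute[of u "e * y'"] trace_re_commute[of y' "u * e"] by (simp_all add: mult.assoc)
  have "(u * y' - y' * u) * (u * y' - y' * u) = e - e * (y' * u) - y' * u * e + y' * u"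
  proof -
    have "(e - y' * u) * (e - y' * u) = e * e - e * (y' * u) - y' * u * e + (y' * u) * (y' * u)"
      by (simp add: algebra_simps)
    moreover have "(y' * u) * (y' * u) = y' * (u * y') * u"
      by (simp only: mult.assoc)
    ultimately show ?thesis
      using e(1) by (simp only: uy ye)
  qed
  then have "trace_re ((u * y' - y' * u) * (u * y' - y' * u)) = trace_re e + trace_re (y' * u)"
    using t0 by simp
  also have "\<dots> = 2 * trace_re e"
    using trace_re_commute[of y' u] uy by simp
  finally show False
    using trace_commutator[OF u(1) y'_in] trace_re_idempotent_pos[OF e] by simp
qed

end

section \<open>Operators on a simple subquotient\<close>

context qmat_algebra
begin

definition invariant :: "(quat^'n) set \<Rightarrow> bool" where
  "invariant S \<longleftrightarrow> quat_subspace S \<and> (\<forall>x\<in>\<A>. \<forall>v\<in>S. act x v \<in> S)"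

end

text \<open>The quotient \<open>W / U\<close> is never formed: its vectors are those of
  \<open>W\<close>, compared modulo \<open>U\<close>. Simplicity refers to subspaces stable under
  both \<open>\<A>\<close> and the right scalars.\<close>

locale simple_quotient = trace_negative_algebra +
  fixes U W :: "(quat^'a) set"
  assumes U: "invariant U" and W: "invariant W" and U_less_W: "U \<subset> W"
    and simple: "invariant S \<Longrightarrow> U \<subseteq> S \<Longrightarrow> S \<subseteq> W \<Longrightarrow> S = U \<or> S = W"
begin

lemma U_closed: "0 \<in> U" "v \<in> U \<Longrightarrow> w \<in> U \<Longrightarrow> v + w \<in> U" "v \<in> U \<Longrightarrow> w \<in> U \<Longrightarrow> v - w \<in> U"
  "v \<in> U \<Longrightarrow> - v \<in> U" "v \<in> U \<Longrightarrow> r *\<^sub>R v \<in> U" "v \<in> U \<Longrightarrow> v \<bullet>\<^sub>q c \<in> U" "x \<in> \<A> \<Longrightarrow> v \<in> U \<Longrightarrow> act x v \<in> U"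
  using U quat_subspace_subspace[of U] unfolding invariant_def quat_subspace_def
  by (auto intro: subspace_diff subspace_neg subspace_scale)

lemma W_closed: "0 \<in> W" "v \<in> W \<Longrightarrow> w \<in> W \<Longrightarrow> v + w \<in> W" "v \<in> W \<Longrightarrow> w \<in> W \<Longrightarrow> v - w \<in> W"
  "v \<in> W \<Longrightarrow> - v \<in> W" "v \<in> W \<Longrightarrow> r *\<^sub>R v \<in> W" "v \<in> W \<Longrightarrow> v \<bullet>\<^sub>q c \<in> W" "x \<in> \<A> \<Longrightarrow> v \<in> W \<Longrightarrow> act x v \<in> W"
  using W quat_subspace_subspace[of W] unfolding invariant_def quat_subspace_def
  by (auto intro: subspace_diff subspace_neg subspace_scale)

lemma U_le_W: "v \<in> U \<Longrightarrow> v \<in> W"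
  using U_less_W by blast

text \<open>The elements of \<open>\<A>\<close> with this property form the annihilator of
  \<open>W / U\<close>, a two-sided ideal of \<open>\<A>\<close>; operators on \<open>W / U\<close>
  are elements of \<open>\<A>\<close> modulo it.\<close>

definition kills :: "'a qmat \<Rightarrow> bool" where
  "kills x \<longleftrightarrow> (\<forall>v\<in>W. act x v \<in> U)"

definition nil :: "'a qmat \<Rightarrow> bool" where
  "nil x \<longleftrightarrow> (\<exists>m. \<forall>v\<in>W. act (x ^ m) v \<in> U)"

lemma kills_closed: "kills 0" "kills x \<Longrightarrow> kills y \<Longrightarrow> kills (x + y)" "kills x \<Longrightarrow> kills y \<Longrightarrow> kills (x - y)"
  "kills x \<Longrightarrow> kills (r *\<^sub>R x)" "x \<in> \<A> \<Longrightarrow> kills y \<Longrightarrow> kills (x * y)" "y \<in> \<A> \<Longrightarrow> kills x \<Longrightarrow> kills (x * y)"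
  unfolding kills_def by (auto intro: U_closed W_closed)

lemma not_kills_1: "\<not> kills 1"
  unfolding kills_def using U_less_W by auto

lemma kills_power_diff:
  assumes "x \<in> \<A>" "y \<in> \<A>" "kills (x - y)"
  shows "kills (x ^ m - y ^ m)"
proof (induction m)
  case (Suc m)
  have "x ^ Suc m - y ^ Suc m = x * (x ^ m - y ^ m) + (x - y) * y ^ m"
    by (simp add: algebra_simps)
  then show ?case
    using Suc.IH assms by (simp only: kills_closed closed)
qed (simp add: kills_closed)

text \<open>Nilpotents lift. The Fitting idempotent \<open>x * s\<close> equals
  \<open>x ^ m * (s ^ m * (x * s))\<close>, so it kills once \<open>x ^ m\<close> does. Hence
  \<open>x\<close> agrees modulo the annihilator with \<open>x * (1 - x * s)\<close>, which is
  nilpotent as a matrix, and \<open>nilpotent_mult\<close> applies.\<close>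

lemma nil_mult:
  assumes "x \<in> \<A>" "nil x" "y \<in> \<A>"
  shows "nil (x * y)"
proof -
  obtain m where m: "\<And>v. v \<in> W \<Longrightarrow> act (x ^ m) v \<in> U"
    using assms(2) unfolding nil_def by blast
  obtain s k where s: "s \<in> \<A>" "s * x = x * s" "(x * s) * (x * s) = x * s"
    "(x * (1 - x * s)) ^ k = 0"
    using fitting_idempotent[OF assms(1)] by metis
  have "x * s = x ^ j * (s ^ j * (x * s))" for j
  proof (induction j)
    case (Suc j)
    have s_comm: "s * (x * s) = (x * s) * s"
      using s(2) by (simp flip: mult.assoc)
    have "x ^ Suc j * (s ^ Suc j * (x * s)) = x * (x ^ j * (s ^ j * (x * s))) * s"
    proof -
      have "x ^ Suc j * (s ^ Suc j * (x * s)) = x * x ^ j * (s ^ j * (s * (x * s)))"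
        by (subst power_Suc2[of s]) (simp add: mult.assoc)
      then show ?thesis
        unfolding s_comm by (simp only: mult.assoc)
    qed
    also have "\<dots> = x * (x * s) * s"
      using Suc.IH by simp
    also have "\<dots> = (x * s) * (x * s)"
      by (simp only: mult.assoc s_comm)
    finally show ?case
      using s(3) by simp
  qed simp
  then have "x * s = x ^ m * (s ^ m * (x * s))" .
  moreover have "kills (x ^ m * (s ^ m * (x * s)))"
    unfolding kills_def
  proof
    fix v assume "v \<in> W"
    then show "act (x ^ m * (s ^ m * (x * s))) v \<in> U"
      unfolding act_simps(1)[of "x ^ m"] using assms s by (intro m W_closed closed)
  qed
  ultimately have "kills (x * s)"
    by simp
  then have "kills (x * (x * s) * y)"
    using assms by (auto intro: kills_closed(5,6))
  moreover have "x * y - x * (1 - x * s) * y = x * (x * s) * y"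
    by (simp add: algebra_simps)
  ultimately have diff: "kills (x * y - x * (1 - x * s) * y)"
    by simp
  have in_A: "x * y \<in> \<A>" "x * (1 - x * s) \<in> \<A>" "x * (1 - x * s) * y \<in> \<A>"
    using assms s by (auto intro!: closed)
  obtain N where N: "(x * (1 - x * s) * y) ^ N = 0"
    using nilpotent_mult[OF in_A(2) s(4) assms(3)] by blast
  have "kills ((x * y) ^ N)"
    using kills_power_diff[OF in_A(1,3) diff, of N] N by simp
  then show ?thesis
    unfolding nil_def kills_def by blast
qed

text \<open>Among the nil elements that do not kill, take \<open>z\<close> with the smallest image
  \<open>R z\<close> modulo \<open>U\<close>. Then \<open>z * y * z\<close> kills for every
  \<open>y\<close>: otherwise it has the same image as \<open>z\<close>, so \<open>z * y\<close>
  maps this image onto itself modulo \<open>U\<close>, although it is nil. Simplicity then forces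
  \<open>z\<close> to kill.\<close>

lemma nil_imp_kills:
  assumes "x \<in> \<A>" "nil x"
  shows "kills x"
proof (rule ccontr)
  assume "\<not> kills x"
  define R where "R = (\<lambda>x. {act x v + u | v u. v \<in> W \<and> u \<in> U})"
  have sub_R: "subspace (R x)" for x
  proof (rule subspaceI)
    show "0 \<in> R x"
      unfolding R_def using W_closed(1) U_closed(1) by force
  next
    fix a b assume "a \<in> R x" "b \<in> R x"
    then obtain v u v' u' where "a = act x v + u" "b = act x v' + u'" "v \<in> W" "v' \<in> W" "u \<in> U" "u' \<in> U"
      unfolding R_def by auto
    then have "a + b = act x (v + v') + (u + u')" "v + v' \<in> W" "u + u' \<in> U"
      by (auto intro: U_closed W_closed)
    then show "a + b \<in> R x"
      unfolding R_def by blast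
  next
    fix a r assume "a \<in> R x"
    then obtain v u where "a = act x v + u" "v \<in> W" "u \<in> U"
      unfolding R_def by auto
    then have "r *\<^sub>R a = act x (r *\<^sub>R v) + r *\<^sub>R u" "r *\<^sub>R v \<in> W" "r *\<^sub>R u \<in> U"
      by (auto intro: U_closed W_closed simp: scaleR_add_right)
    then show "r *\<^sub>R a \<in> R x"
      unfolding R_def by blast
  qed
  obtain z where z: "z \<in> \<A>" "nil z" "\<not> kills z"
    "\<And>y. y \<in> \<A> \<Longrightarrow> nil y \<Longrightarrow> \<not> kills y \<Longrightarrow> dim (R z) \<le> dim (R y)"
    using ex_has_least_nat[of "\<lambda>x. x \<in> \<A> \<and> nil x \<and> \<not> kills x" x "\<lambda>x. dim (R x)"] assms \<open>\<not> kills x\<close>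
    by blast
  have zyz: "kills (z * y * z)" if y: "y \<in> \<A>" for y
  proof (rule ccontr)
    assume not_kills: "\<not> kills (z * y * z)"
    have "nil (z * (y * z))"
      using z y by (intro nil_mult closed)
    then have "dim (R z) \<le> dim (R (z * y * z))"
      using z y not_kills by (intro z(4)) (auto intro: closed simp: mult.assoc)
    moreover have "R (z * y * z) \<subseteq> R z"
      unfolding R_def using z(1) y W_closed(7) by (auto) blast
    ultimately have R_eq: "R (z * y * z) = R z"
      using sub_R by (intro subspace_dim_equal)
    define a where "a = z * y"
    have a: "a \<in> \<A>" "nil a"
      using z y by (auto simp: a_def intro: closed nil_mult)
    \<comment> \<open>Equality of the two images lets every vector \<open>z v\<close> be written,
      modulo \<open>U\<close>, as \<open>a ^ m\<close> applied to some \<open>z v'\<close>, for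
      every \<open>m\<close>.\<close>
    have rep: "\<exists>v'\<in>W. act z v - act (a ^ m) (act z v') \<in> U" if "v \<in> W" for v m
      using that
    proof (induction m arbitrary: v)
      case 0
      then show ?case
        using U_closed(1) by (intro bexI[of _ v]) auto
    next
      case (Suc m)
      obtain v1 where v1: "v1 \<in> W" "act z v - act (a ^ m) (act z v1) \<in> U"
        using Suc by blast
      have "act z v1 \<in> R z"
        unfolding R_def using v1(1) U_closed(1) by force
      then have "act z v1 \<in> R (z * y * z)"
        by (simp only: R_eq)
      then obtain v2 u where v2: "v2 \<in> W" "u \<in> U" "act z v1 = act a (act z v2) + u"
        unfolding R_def a_def by auto
      have "act z v - act (a ^ Suc m) (act z v2)
          = act z v - act (a ^ m) (act z v1) + act (a ^ m) u"
        by (simp only: v2(3) power_Suc2 act_simps) simp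
      moreover have "\<dots> \<in> U"
        using v1(2) U_closed(7)[OF power_in[OF a(1)] v2(2)] by (rule U_closed(2))
      ultimately show ?case
        using v2(1) by (intro bexI[of _ v2]) (simp_all only:)
    qed
    obtain m where m: "\<And>v. v \<in> W \<Longrightarrow> act (a ^ m) v \<in> U"
      using a(2) unfolding nil_def by blast
    have "act z v \<in> U" if v: "v \<in> W" for v
    proof -
      obtain v' where v': "v' \<in> W" "act z v - act (a ^ m) (act z v') \<in> U"
        using rep[OF v] by blast
      then have "(act z v - act (a ^ m) (act z v')) + act (a ^ m) (act z v') \<in> U"
        using z(1) by (intro U_closed(2) m W_closed)
      then show ?thesis
        by simp
    qed
    then show False
      using z(3) unfolding kills_def by blast
  qed
  \<comment> \<open>The vectors all of whose translates under \<open>\<A>\<close> are sent into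
    \<open>U\<close> by \<open>z\<close>. The image of \<open>z\<close> lies in this invariant
    subspace but not in \<open>U\<close>, so it is all of \<open>W\<close>.\<close>
  define S where "S = {v \<in> W. \<forall>y\<in>\<A>. act z (act y v) \<in> U}"
  have "invariant S"
    unfolding invariant_def quat_subspace_def
  proof (intro conjI ballI allI)
    show "0 \<in> S"
      unfolding S_def by (simp add: U_closed W_closed)
    show "v + w \<in> S" if "v \<in> S" "w \<in> S" for v w
      using that unfolding S_def by (simp add: U_closed W_closed)
    show "v \<bullet>\<^sub>q c \<in> S" if "v \<in> S" for v c
      using that unfolding S_def by (simp add: U_closed W_closed)
    show "act x v \<in> S" if "x \<in> \<A>" "v \<in> S" for x v
    proof -
      have "act z (act y (act x v)) \<in> U" if "y \<in> \<A>" for y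
        using \<open>v \<in> S\<close> mult_in[OF \<open>y \<in> \<A>\<close> \<open>x \<in> \<A>\<close>] unfolding S_def by force
      then show ?thesis
        using that unfolding S_def by (simp add: W_closed)
    qed
  qed
  moreover have "U \<subseteq> S" "S \<subseteq> W"
    unfolding S_def using z(1) U_le_W by (auto intro: U_closed)
  ultimately have "S = U \<or> S = W"
    by (rule simple)
  moreover obtain v where v: "v \<in> W" "act z v \<notin> U"
    using z(3) unfolding kills_def by blast
  moreover have "act z v \<in> S"
    unfolding S_def using v(1) z(1) zyz unfolding kills_def by (auto intro: W_closed)
  ultimately have "v \<in> S"
    by blast
  then show False
    using v(2) one_in unfolding S_def by force
qed

text \<open>This makes the operators on \<open>W / U\<close> a division ring. If the Fitting
  idempotent \<open>w * s\<close> killed, so would \<open>w ^ k = w * s * w ^ k\<close>; then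
  \<open>w\<close> would be nil and would kill.\<close>

lemma inverse_exists:
  assumes w: "w \<in> \<A>" "\<not> kills w"
  obtains s where "s \<in> \<A>" "s * w = w * s" "kills (w * s - 1)"
proof -
  obtain s k where s: "s \<in> \<A>" "s * w = w * s" "(w * s) * (w * s) = w * s"
    "w * s * w ^ k = w ^ k"
    using fitting_idempotent[OF w(1)] by metis
  define e where "e = w * s"
  have e: "e \<in> \<A>" "e * e = e" "\<not> kills e"
  proof -
    show "e \<in> \<A>" "e * e = e"
      using w s by (auto simp: e_def intro: closed)
    show "\<not> kills e"
    proof
      assume "kills e"
      then have "kills (w ^ k)"
        using s(4) w(1) kills_closed(6)[of "w ^ k" e] by (auto simp: e_def intro: closed)
      then show False
        using nil_imp_kills w unfolding nil_def kills_def by blast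
    qed
  qed
  text \<open>A nonzero element of the reduced algebra of operators on \<open>W / U\<close> gives a nonzero idempotent,
    which is central and hence, by simplicity, the identity.\<close>
  have corner: "kills ((1 - e) * y * e)" if y: "y \<in> \<A>" for y
  proof (rule nil_imp_kills)
    show "(1 - e) * y * e \<in> \<A>"
      using e y by (intro closed)
    have "((1 - e) * y * e) * ((1 - e) * y * e) = (1 - e) * y * ((e - e * e) * (y * e))"
      by (simp add: algebra_simps)
    then have "((1 - e) * y * e) ^ 2 = 0"
      using e(2) by (simp add: power2_eq_square)
    then show "nil ((1 - e) * y * e)"
      unfolding nil_def by (metis act_simps(3) U_closed(1))
  qed
  \<comment> \<open>The vectors of \<open>W\<close> fixed by \<open>e\<close> modulo
    \<open>U\<close>, a subspace that contains the image of \<open>e\<close>; \<open>corner\<close>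
    makes it stable under \<open>\<A>\<close>.\<close>
  define S where "S = {v \<in> W. act (1 - e) v \<in> U}"
  have "invariant S"
    unfolding invariant_def quat_subspace_def
  proof (intro conjI ballI allI)
    show "0 \<in> S"
      unfolding S_def by (simp add: U_closed W_closed)
    show "v + w \<in> S" if "v \<in> S" "w \<in> S" for v w
      using that U_closed(2)[of "act (1 - e) v" "act (1 - e) w"] unfolding S_def
      by (simp add: W_closed algebra_simps)
    show "v \<bullet>\<^sub>q c \<in> S" if "v \<in> S" for v c
      using that U_closed(6)[of "act (1 - e) v" c] unfolding S_def
      by (simp add: W_closed)
    show "act y v \<in> S" if "y \<in> \<A>" "v \<in> S" for y v
    proof -
      have "act (1 - e) (act y v) = act ((1 - e) * y * e) v + act ((1 - e) * y) (act (1 - e) v)"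
        by simp
      also have "\<dots> \<in> U"
      proof (rule U_closed(2))
        show "act ((1 - e) * y * e) v \<in> U"
          using that(2) corner[OF that(1)] unfolding S_def kills_def by blast
        show "act ((1 - e) * y) (act (1 - e) v) \<in> U"
          using that e(1) unfolding S_def by (auto intro!: U_closed(7) closed simp del: act_simps)
      qed
      finally show ?thesis
        using that by (auto simp: S_def intro: W_closed)
    qed
  qed
  moreover have "U \<subseteq> S" "S \<subseteq> W"
    unfolding S_def using e(1) U_le_W by (auto intro!: U_closed closed simp del: act_simps(6))
  ultimately have "S = U \<or> S = W"
    by (rule simple)
  moreover obtain v where v: "v \<in> W" "act e v \<notin> U"
    using e(3) unfolding kills_def by blast
  moreover have "act (1 - e) (act e v) = act (e - e * e) v"
    by simp
  then have "act e v \<in> S"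
    using v(1) e(1,2) unfolding S_def by (auto intro: W_closed U_closed)
  ultimately have "S = W"
    by blast
  then have "kills (1 - e)"
    unfolding kills_def S_def by blast
  then have "kills (w * s - 1)"
    using kills_closed(4)[of "1 - e" "-1"] by (simp add: e_def)
  then show ?thesis
    using that s by blast
qed

text \<open>An invertible operator on \<open>W / U\<close> has no kernel. Hence an identity between
  operators can be checked at a single vector outside \<open>U\<close>.\<close>

lemma act_zero_imp_kills:
  assumes "x \<in> \<A>" "v \<in> W" "v \<notin> U" "act x v \<in> U"
  shows "kills x"
proof (rule ccontr)
  assume "\<not> kills x"
  then obtain s where s: "s \<in> \<A>" "s * x = x * s" "kills (x * s - 1)"
    using inverse_exists assms(1) by blast
  have "v = act s (act x v) - act (s * x - 1) v"
    by simp
  also have "\<dots> \<in> U"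
    using assms s by (intro U_closed(3)) (auto intro: U_closed simp: kills_def)
  finally show False
    using assms(3) by simp
qed

lemma kills_mult_iff:
  assumes "x \<in> \<A>" "y \<in> \<A>"
  shows "kills (x * y) \<longleftrightarrow> kills x \<or> kills y"
proof
  assume *: "kills (x * y)"
  show "kills x \<or> kills y"
  proof (rule disjCI)
    assume "\<not> kills y"
    then obtain v where v: "v \<in> W" "act y v \<notin> U"
      unfolding kills_def by blast
    then show "kills x"
      using * assms act_zero_imp_kills[of x "act y v"] unfolding kills_def by (auto intro: W_closed)
  qed
qed (use assms in \<open>auto intro: kills_closed(5,6)\<close>)

end

section \<open>Common eigenvectors\<close>

text \<open>The coefficients are indexed by \<open>I\<close> and not by the image, which covers a
  \<open>g\<close> with repeated values.\<close>

lemma span_finite_image_sum: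
  assumes "finite I" "x \<in> span (g ` I)"
  obtains c where "x = (\<Sum>i\<in>I. c i *\<^sub>R g i)"
proof -
  have "span (g ` I) \<subseteq> range (\<lambda>c. \<Sum>i\<in>I. c i *\<^sub>R g i)"
  proof (rule span_minimal)
    show "g ` I \<subseteq> range (\<lambda>c. \<Sum>i\<in>I. c i *\<^sub>R g i)"
    proof safe
      fix j assume "j \<in> I"
      then have "g j = (\<Sum>i\<in>I. (if i = j then 1 else 0) *\<^sub>R g i)"
        using assms(1) by (simp add: if_distrib[where f = "\<lambda>x. x *\<^sub>R _"] cong: if_cong)
      then show "g j \<in> range (\<lambda>c. \<Sum>i\<in>I. c i *\<^sub>R g i)"
        by (intro range_eqI[where x = "\<lambda>i. if i = j then 1 else 0"])
    qed
    show "subspace (range (\<lambda>c. \<Sum>i\<in>I. c i *\<^sub>R g i))"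
    proof (rule subspaceI)
      show "0 \<in> range (\<lambda>c. \<Sum>i\<in>I. c i *\<^sub>R g i)"
        by (rule range_eqI[of _ _ "\<lambda>_. 0"]) simp
    next
      fix a b assume "a \<in> range (\<lambda>c. \<Sum>i\<in>I. c i *\<^sub>R g i)" "b \<in> range (\<lambda>c. \<Sum>i\<in>I. c i *\<^sub>R g i)"
      then obtain c d where "a = (\<Sum>i\<in>I. c i *\<^sub>R g i)" "b = (\<Sum>i\<in>I. d i *\<^sub>R g i)"
        by blast
      then show "a + b \<in> range (\<lambda>c. \<Sum>i\<in>I. c i *\<^sub>R g i)"
        by (intro range_eqI[of _ _ "\<lambda>i. c i + d i"]) (simp add: scaleR_add_left sum.distrib)
    next
      fix a r assume "a \<in> range (\<lambda>c. \<Sum>i\<in>I. c i *\<^sub>R g i)"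
      then obtain c where "a = (\<Sum>i\<in>I. c i *\<^sub>R g i)"
        by blast
      then show "r *\<^sub>R a \<in> range (\<lambda>c. \<Sum>i\<in>I. c i *\<^sub>R g i)"
        by (intro range_eqI[of _ _ "\<lambda>i. r * c i"]) (simp add: scaleR_sum_right)
    qed
  qed
  then show ?thesis
    using that assms(2) by auto
qed

text \<open>Otherwise no term is in the span of its predecessors, and the first
  \<open>DIM('a) + 1\<close> terms are independent.\<close>

lemma ex_linear_recurrence:
  fixes f :: "nat \<Rightarrow> 'a::euclidean_space"
  shows "\<exists>n c. f n = (\<Sum>i<n. c i *\<^sub>R f i)"
proof (rule ccontr)
  assume *: "\<nexists>n c. f n = (\<Sum>i<n. c i *\<^sub>R f i)"
  have not_span: "f n \<notin> span (f ` {..<n})" for n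
  proof
    assume "f n \<in> span (f ` {..<n})"
    then obtain c where "f n = (\<Sum>i<n. c i *\<^sub>R f i)"
      by (rule span_finite_image_sum[OF finite_lessThan])
    then have "\<exists>n c. f n = (\<Sum>i<n. c i *\<^sub>R f i)"
      by (intro exI)
    with * show False
      by (rule notE)
  qed
  have "independent (f ` {..<n}) \<and> card (f ` {..<n}) = n" for n
  proof (induction n)
    case (Suc n)
    have "f n \<notin> f ` {..<n}"
      using not_span[of n] by (rule contrapos_nn) (rule span_base)
    then show ?case
      using Suc not_span[of n] by (simp add: lessThan_Suc independent_insertI)
  qed (simp add: independent_empty)
  from this[of "Suc DIM('a)"] show False
    using independent_bound[of "f ` {..<Suc DIM('a)}"] by simp
qed

section \<open>Complex polynomials acting on a column vector\<close>

definition quat_of_complex :: "complex \<Rightarrow> quat" where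
  "quat_of_complex z = Quat (Re z) (Im z) 0 0"

lemma quat_of_complex_simps [simp]:
  "quat_of_complex (z + w) = quat_of_complex z + quat_of_complex w"
  "quat_of_complex (z * w) = quat_of_complex z * quat_of_complex w"
  "quat_of_complex (- z) = - quat_of_complex z"
  "quat_of_complex 0 = 0" "quat_of_complex 1 = 1" "quat_of_complex (of_real r) = of_real r"
  by (simp_all add: quat_of_complex_def quat_eq_iff of_real_def)

lemma quat_of_complex_commute: "quat_of_complex z * quat_of_complex w = quat_of_complex w * quat_of_complex z"
  by (simp add: quat_of_complex_def quat_eq_iff)

text \<open>Horner form of the sum of
  \<open>act (x ^ i) v \<bullet>\<^sub>q quat_of_complex a\<close> over the coefficients
  \<open>a\<close> of \<open>p\<close> at \<open>i\<close>. Right scalars commute with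
  \<open>act\<close>, and complex ones with each other, so factoring \<open>p\<close> is meaningful
  here.\<close>

definition complex_poly_act :: "'n::finite qmat \<Rightarrow> complex poly \<Rightarrow> quat^'n \<Rightarrow> quat^'n" where
  "complex_poly_act x p v = fold_coeffs (\<lambda>a u. v \<bullet>\<^sub>q quat_of_complex a + act x u) p 0"

lemma complex_poly_act_pCons [simp]:
  "complex_poly_act x (pCons a p) v = v \<bullet>\<^sub>q quat_of_complex a + act x (complex_poly_act x p v)"
  by (cases "p = 0 \<and> a = 0") (auto simp: complex_poly_act_def)

lemma complex_poly_act_0 [simp]: "complex_poly_act x 0 v = 0"
  by (simp add: complex_poly_act_def)

lemma complex_poly_act_add [simp]:
  "complex_poly_act x (p + q) v = complex_poly_act x p v + complex_poly_act x q v"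
  by (induction p q rule: poly_induct2) (simp_all add: algebra_simps)

lemma complex_poly_act_smult [simp]:
  "complex_poly_act x (smult c p) v = complex_poly_act x p v \<bullet>\<^sub>q quat_of_complex c"
  by (induction p) (simp_all add: quat_of_complex_commute)

lemma complex_poly_act_monom:
  "complex_poly_act x (monom c i) v = act (x ^ i) v \<bullet>\<^sub>q quat_of_complex c"
  by (induction i) (simp_all add: monom_0 monom_Suc)

lemma complex_poly_act_sum:
  "complex_poly_act x (\<Sum>i\<in>I. p i) v = (\<Sum>i\<in>I. complex_poly_act x (p i) v)"
  by (induction I rule: infinite_finite_induct) simp_all

text \<open>A real linear recurrence among the vectors \<open>act (x ^ i) v\<close> yields a monic
  annihilating polynomial.\<close>

lemma complex_poly_act_annihilates: "\<exists>p. p \<noteq> 0 \<and> complex_poly_act x p v = 0"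
proof -
  obtain n c where c: "act (x ^ n) v = (\<Sum>i<n. c i *\<^sub>R act (x ^ i) v)"
    using ex_linear_recurrence[of "\<lambda>i. act (x ^ i) v"] by blast
  define p :: "complex poly" where "p = monom 1 n + (\<Sum>i<n. monom (of_real (- c i)) i)"
  have "coeff p n = 1"
    unfolding p_def by (simp add: coeff_sum)
  then have "p \<noteq> 0"
    by auto
  moreover have "complex_poly_act x p v = 0"
    unfolding p_def
    by (simp add: complex_poly_act_sum complex_poly_act_monom c rscale_of_real sum_negf del: of_real_minus)
  ultimately show ?thesis
    by blast
qed

section \<open>Eigenvectors modulo U and the Frobenius classification\<close>

context simple_quotient
begin

text \<open>Linear factors are removed from an annihilating polynomial of \<open>v\<close>. If
  \<open>p = (X - z) * q\<close> and \<open>q\<close> applied to \<open>v\<close> is outside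
  \<open>U\<close>, that vector is an eigenvector for \<open>z\<close>; otherwise continue with
  \<open>q\<close>. A nonzero constant cannot send \<open>v\<close> into \<open>U\<close>. Only
  complex right scalars act on \<open>S\<close>, so \<open>S\<close> may be the eigenspace of an
  imaginary unit.\<close>

lemma complex_eigenvector:
  assumes x: "x \<in> \<A>"
    and S: "0 \<in> S" "\<And>v w. v \<in> S \<Longrightarrow> w \<in> S \<Longrightarrow> v + w \<in> S"
      "\<And>v z. v \<in> S \<Longrightarrow> v \<bullet>\<^sub>q quat_of_complex z \<in> S" "\<And>v. v \<in> S \<Longrightarrow> act x v \<in> S" "\<not> S \<subseteq> U"
  obtains v z where "v \<in> S" "v \<notin> U" "act x v - v \<bullet>\<^sub>q quat_of_complex z \<in> U"
proof -
  obtain v where v: "v \<in> S" "v \<notin> U"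
    using S(5) by blast
  have pS: "complex_poly_act x p v \<in> S" for p
    by (induction p) (simp_all add: S(1-4) v)
  have "\<exists>v\<in>S. \<exists>z. v \<notin> U \<and> act x v - v \<bullet>\<^sub>q quat_of_complex z \<in> U"
    if "p \<noteq> 0" "complex_poly_act x p v \<in> U" for p
    using that
  proof (induction "degree p" arbitrary: p rule: less_induct)
    case less
    show ?case
    proof (cases "degree p = 0")
      case True
      then obtain c where p: "p = [:c:]"
        using degree_eq_zeroE by blast
      then have "v \<bullet>\<^sub>q quat_of_complex c \<bullet>\<^sub>q quat_of_complex (inverse c) \<in> U"
        using less.prems(2) by (intro U_closed(6)[of "v \<bullet>\<^sub>q quat_of_complex c"]) simp
      moreover have "quat_of_complex c * quat_of_complex (inverse c) = quat_of_complex (c * inverse c)"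
        by (simp only: quat_of_complex_simps)
      moreover have "c \<noteq> 0"
        using p less.prems(1) by auto
      ultimately show ?thesis
        using v(2) by (simp del: quat_of_complex_simps(2))
    next
      case False
      then obtain z where "poly p z = 0"
        using fundamental_theorem_of_algebra[of p] constant_degree[of p] by auto
      then obtain q where q: "p = [:- z, 1:] * q"
        by (auto simp: poly_eq_0_iff_dvd)
      then have "q \<noteq> 0"
        using less.prems(1) by auto
      then have "degree q < degree p"
        unfolding q by (subst degree_mult_eq) auto
      show ?thesis
      proof (cases "complex_poly_act x q v \<in> U")
        case True
        then show ?thesis
          using less.hyps \<open>degree q < degree p\<close> \<open>q \<noteq> 0\<close> by blast
      next
        case False
        have "complex_poly_act x p v
            = act x (complex_poly_act x q v) - complex_poly_act x q v \<bullet>\<^sub>q quat_of_complex z"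
        proof -
          have "p = pCons 0 q + smult (- z) q"
            unfolding q by simp
          then show ?thesis
            by (simp only: complex_poly_act_pCons complex_poly_act_add complex_poly_act_smult) simp
        qed
        then show ?thesis
          using less.prems(2) False pS by metis
      qed
    qed
  qed
  then show ?thesis
    using that complex_poly_act_annihilates[of x v] U_closed(1) by metis
qed

text \<open>On an eigenvector with eigenvalue \<open>Re z + b i\<close>, the operator
  \<open>N = x - Re z\<close> satisfies \<open>N * N = - b\<^sup>2\<close>, hence everywhere modulo
  the annihilator. If \<open>b = 0\<close>, then \<open>N\<close> would kill; so
  \<open>N / b\<close> is an imaginary unit.\<close>

lemma real_or_imaginary_unit:
  assumes x: "x \<in> \<A>" "\<And>a. \<not> kills (x - a *\<^sub>R 1)"
  obtains I where "I \<in> \<A>" "kills (I * I + 1)"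
proof -
  obtain v z where v: "v \<in> W" "v \<notin> U" "act x v - v \<bullet>\<^sub>q quat_of_complex z \<in> U"
    by (rule complex_eigenvector[of x W]) (use x(1) W_closed U_less_W in auto)
  define N where "N = x - Re z *\<^sub>R 1"
  define b where "b = Im z"
  have N: "N \<in> \<A>" "\<not> kills N"
    using x by (auto simp: N_def intro: closed)
  define u where "u = act x v - v \<bullet>\<^sub>q quat_of_complex z"
  have u: "u \<in> U"
    using v by (simp add: u_def)
  have z: "quat_of_complex z = of_real (Re z) + b *\<^sub>R quat_i"
    by (simp add: quat_of_complex_def quat_eq_iff of_real_def b_def)
  have Nv: "act N v = b *\<^sub>R (v \<bullet>\<^sub>q quat_i) + u"
    by (simp add: N_def u_def z rscale_of_real)
  have "act (N * N + b\<^sup>2 *\<^sub>R 1) v = act N u + b *\<^sub>R (u \<bullet>\<^sub>q quat_i)"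
    by (simp add: Nv quat_units_mult scaleR_add_right scaleR_diff_right power2_eq_square)
  also have "\<dots> \<in> U"
    using u N by (intro U_closed)
  finally have *: "kills (N * N + b\<^sup>2 *\<^sub>R 1)"
    using act_zero_imp_kills[OF _ v(1,2)] N by (meson closed)
  have "b \<noteq> 0"
  proof
    assume "b = 0"
    then show False
      using * N kills_mult_iff by simp
  qed
  moreover have "kills ((1 / b\<^sup>2) *\<^sub>R (N * N + b\<^sup>2 *\<^sub>R 1))"
    using * by (rule kills_closed)
  moreover have "(1 / b\<^sup>2) *\<^sub>R (N * N + b\<^sup>2 *\<^sub>R 1) = ((1 / b) *\<^sub>R N) * ((1 / b) *\<^sub>R N) + 1" if "b \<noteq> 0"
    using that by (simp add: scaleR_add_right power2_eq_square)
  ultimately show ?thesis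
    using that[of "(1 / b) *\<^sub>R N"] N by (auto intro: closed)
qed

text \<open>Because \<open>I * I = -1\<close> modulo the annihilator,
  \<open>v w = w - act I w \<bullet>\<^sub>q quat_i\<close> is always an eigenvector for
  \<open>quat_i\<close>. It cannot vanish modulo \<open>U\<close> for both \<open>w\<close> and
  \<open>w \<bullet>\<^sub>q quat_j\<close>, since \<open>v w - v (w \<bullet>\<^sub>q quat_j)
  \<bullet>\<^sub>q quat_j = w + w\<close>.\<close>

lemma imaginary_unit_eigenspace_nontrivial:
  assumes I: "I \<in> \<A>" "kills (I * I + 1)"
  shows "\<exists>v\<in>W. v \<notin> U \<and> act I v - v \<bullet>\<^sub>q quat_i \<in> U"
proof -
  obtain w where w: "w \<in> W" "w \<notin> U"
    using U_less_W by blast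
  have II: "act I (act I v) + v \<in> U" if "v \<in> W" for v
    using I(2) that unfolding kills_def by force
  define v where "v = (\<lambda>w. w - act I w \<bullet>\<^sub>q quat_i)"
  have v_eig: "v w \<in> W" "act I (v w) - v w \<bullet>\<^sub>q quat_i \<in> U" if "w \<in> W" for w
  proof -
    show "v w \<in> W"
      using that I(1) by (auto simp: v_def intro: W_closed)
    have "act I (v w) - v w \<bullet>\<^sub>q quat_i = - ((act I (act I w) + w) \<bullet>\<^sub>q quat_i)"
      by (simp add: v_def quat_units_mult)
    also have "\<dots> \<in> U"
      using II[OF that] by (intro U_closed(4,6))
    finally show "act I (v w) - v w \<bullet>\<^sub>q quat_i \<in> U" .
  qed
  have "v w \<notin> U \<or> v (w \<bullet>\<^sub>q quat_j) \<notin> U"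
  proof (rule ccontr)
    assume "\<not> ?thesis"
    then have "(1 / 2) *\<^sub>R (v w - v (w \<bullet>\<^sub>q quat_j) \<bullet>\<^sub>q quat_j) \<in> U"
      by (auto intro: U_closed)
    moreover have "v w - v (w \<bullet>\<^sub>q quat_j) \<bullet>\<^sub>q quat_j = w + w"
      by (simp add: v_def quat_units_mult mult.assoc)
    ultimately show False
      using w(2) by (simp flip: scaleR_2)
  qed
  then show ?thesis
    using v_eig w(1) W_closed(6) by blast
qed

text \<open>\<open>y\<close> preserves the \<open>quat_i\<close> eigenspace of \<open>I\<close>, a
  complex space, and so has there an eigenvector with some eigenvalue \<open>a + b i\<close>. On it
  \<open>y\<close> and \<open>a + b I\<close> agree modulo \<open>U\<close>, hence they agree as
  operators on \<open>W / U\<close>.\<close>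

lemma commuting_with_imaginary_unit:
  assumes I: "I \<in> \<A>" "kills (I * I + 1)" and y: "y \<in> \<A>" "kills (I * y - y * I)"
  obtains a b where "kills (y - (a *\<^sub>R 1 + b *\<^sub>R I))"
proof -
  define S where "S = {v \<in> W. act I v - v \<bullet>\<^sub>q quat_i \<in> U}"
  have "\<not> S \<subseteq> U"
    using imaginary_unit_eigenspace_nontrivial[OF I] by (auto simp: S_def)
  moreover have "0 \<in> S"
    by (simp add: S_def W_closed U_closed)
  moreover have "v + w \<in> S" if "v \<in> S" "w \<in> S" for v w
    using that U_closed(2)[of "act I v - v \<bullet>\<^sub>q quat_i" "act I w - w \<bullet>\<^sub>q quat_i"]
    by (simp add: S_def W_closed algebra_simps)
  moreover have "v \<bullet>\<^sub>q quat_of_complex z \<in> S" if "v \<in> S" for v z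
  proof -
    have "quat_of_complex z * quat_i = quat_i * quat_of_complex z"
      by (simp add: quat_of_complex_def quat_eq_iff)
    then have "act I (v \<bullet>\<^sub>q quat_of_complex z) - v \<bullet>\<^sub>q quat_of_complex z \<bullet>\<^sub>q quat_i
        = (act I v - v \<bullet>\<^sub>q quat_i) \<bullet>\<^sub>q quat_of_complex z"
      by simp
    also have "\<dots> \<in> U"
      using that by (auto simp: S_def simp del: rscale_simps intro: U_closed(6))
    finally show ?thesis
      using that by (simp add: S_def W_closed)
  qed
  moreover have "act y v \<in> S" if "v \<in> S" for v
  proof -
    have "act I (act y v) - act y v \<bullet>\<^sub>q quat_i = act (I * y - y * I) v + act y (act I v - v \<bullet>\<^sub>q quat_i)"
      by simp
    also have "\<dots> \<in> U"
      using that y unfolding S_def kills_def by (blast intro: U_closed)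
    finally show ?thesis
      using that y(1) by (simp add: S_def W_closed)
  qed
  ultimately obtain v z where v: "v \<in> S" "v \<notin> U" "act y v - v \<bullet>\<^sub>q quat_of_complex z \<in> U"
    using complex_eigenvector[OF y(1), of S] by metis
  have z: "quat_of_complex z = of_real (Re z) + Im z *\<^sub>R quat_i"
    by (simp add: quat_of_complex_def quat_eq_iff of_real_def)
  have "act (y - (Re z *\<^sub>R 1 + Im z *\<^sub>R I)) v
      = (act y v - v \<bullet>\<^sub>q quat_of_complex z) - Im z *\<^sub>R (act I v - v \<bullet>\<^sub>q quat_i)"
    unfolding z by (simp add: rscale_of_real scaleR_diff_right)
  also have "\<dots> \<in> U"
    using v unfolding S_def by (blast intro: U_closed)
  finally have "kills (y - (Re z *\<^sub>R 1 + Im z *\<^sub>R I))"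
    using v(1,2) y(1) I(1) by (intro act_zero_imp_kills[of _ v]) (auto simp: S_def intro!: closed)
  then show ?thesis
    using that by blast
qed

lemma kills_commutator_add:
  assumes "kills (x - y)" "x \<in> \<A>" "y \<in> \<A>" "z \<in> \<A>" "kills (z * y - y * z)"
  shows "kills (z * x - x * z)"
proof -
  have "kills (z * (x - y) - (x - y) * z + (z * y - y * z))"
    using assms by (blast intro: kills_closed closed)
  then show ?thesis
    by (simp add: algebra_simps)
qed

text \<open>Modulo the annihilator, \<open>K = y + I * y * I\<close> anticommutes with
  \<open>I\<close>, and \<open>I * K = I * y - y * I\<close> shows that it is nonzero. Its square
  commutes with \<open>I\<close>, so equals \<open>a + b I\<close>; as \<open>K\<close> commutes
  with its square but not with \<open>I\<close>, \<open>b = 0\<close>. If \<open>a \<ge> 0\<close>,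
  factoring \<open>K * K - a\<close> would make \<open>K\<close> real. So \<open>a < 0\<close>, and
  \<open>K\<close> is rescaled.\<close>

lemma anticommuting_imaginary_unit:
  assumes I: "I \<in> \<A>" "kills (I * I + 1)" and y: "y \<in> \<A>" "\<not> kills (I * y - y * I)"
  obtains J where "J \<in> \<A>" "kills (J * J + 1)" "kills (I * J + J * I)"
proof -
  define K where "K = y + I * y * I"
  have K: "K \<in> \<A>"
    using I y by (auto simp: K_def intro: closed)
  have "I * K + K * I = I * y * (I * I + 1) + (I * I + 1) * (y * I)"
    by (simp add: K_def algebra_simps)
  moreover have "kills (I * y * (I * I + 1) + (I * I + 1) * (y * I))"
    using I y by (blast intro: kills_closed closed)
  ultimately have anti: "kills (I * K + K * I)"
    by simp
  have not_kills_I: "\<not> kills I"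
  proof
    assume "kills I"
    then have "kills (I * I + 1 - I * I)"
      using I by (blast intro: kills_closed closed)
    then show False
      using not_kills_1 by simp
  qed
  have not_kills_K: "\<not> kills K"
  proof
    assume "kills K"
    then have "kills (I * K - (I * I + 1) * (y * I))"
      using I y by (blast intro: kills_closed closed)
    then show False
      using y(2) by (simp add: K_def algebra_simps)
  qed
  have not_comm: "\<not> kills (I * K - K * I)"
  proof
    assume "kills (I * K - K * I)"
    then have "kills ((1 / 2) *\<^sub>R ((I * K - K * I) + (I * K + K * I)))"
      using anti by (blast intro: kills_closed closed)
    then have "kills (I * K)"
      by (simp flip: scaleR_2)
    then show False
      using kills_mult_iff[OF I(1) K] not_kills_I not_kills_K by blast
  qed
  have "kills ((I * K + K * I) * K - K * (I * K + K * I))"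
    using anti I K by (blast intro: kills_closed closed)
  then have "kills (I * (K * K) - K * K * I)"
    by (simp add: algebra_simps)
  then obtain a b where ab: "kills (K * K - (a *\<^sub>R 1 + b *\<^sub>R I))"
    using commuting_with_imaginary_unit[OF I, of "K * K"] K by (auto intro: closed)
  have "kills (K * (K * K - (a *\<^sub>R 1 + b *\<^sub>R I)) - (K * K - (a *\<^sub>R 1 + b *\<^sub>R I)) * K)"
    using ab K by (blast intro: kills_closed closed)
  then have "kills (b *\<^sub>R (I * K - K * I))"
    by (simp add: algebra_simps)
  then have "b = 0"
    using not_comm kills_closed(4)[of "b *\<^sub>R (I * K - K * I)" "1 / b"] by (cases "b = 0") simp_all
  then have KK: "kills (K * K - a *\<^sub>R 1)"
    using ab by simp
  have not_real: "\<not> kills (K - r *\<^sub>R 1)" for r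
  proof
    assume "kills (K - r *\<^sub>R 1)"
    then have "kills (I * K - K * I)"
      using I K by (intro kills_commutator_add[of K "r *\<^sub>R 1" I] closed) (auto simp: kills_closed)
    then show False
      using not_comm by blast
  qed
  have "a < 0"
  proof (rule ccontr)
    assume "\<not> a < 0"
    then have "a *\<^sub>R (1 :: 'a qmat) = sqrt a *\<^sub>R sqrt a *\<^sub>R 1"
      by simp
    then have "K * K - a *\<^sub>R 1 = (K - sqrt a *\<^sub>R 1) * (K - (- sqrt a) *\<^sub>R 1)"
      by (simp add: algebra_simps)
    then show False
      using KK kills_mult_iff[of "K - sqrt a *\<^sub>R 1" "K - (- sqrt a) *\<^sub>R 1"] not_real K
      by (metis closed)
  qed
  define J where "J = (1 / sqrt (- a)) *\<^sub>R K"
  have "kills ((- 1 / a) *\<^sub>R (K * K - a *\<^sub>R 1))" "kills ((1 / sqrt (- a)) *\<^sub>R (I * K + K * I))"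
    using KK anti by (blast intro: kills_closed)+
  moreover have "(- 1 / a) *\<^sub>R (K * K - a *\<^sub>R 1) = J * J + 1"
    using \<open>a < 0\<close> by (simp add: J_def scaleR_diff_right)
  moreover have "(1 / sqrt (- a)) *\<^sub>R (I * K + K * I) = I * J + J * I"
    by (simp add: J_def scaleR_add_right)
  ultimately show ?thesis
    using that[of J] K by (auto simp: J_def intro: closed)
qed

text \<open>The map \<open>f\<close> sends an \<open>quat_i\<close> eigenvector of \<open>I\<close>
  to a \<open>quat_j\<close> eigenvector of \<open>J\<close>, and keeps it an eigenvector of
  \<open>I\<close> because \<open>I\<close> and \<open>J\<close> anticommute as
  \<open>quat_i\<close> and \<open>quat_j\<close> do. It cannot vanish modulo \<open>U\<close> at
  both \<open>v\<close> and \<open>v \<bullet>\<^sub>q quat_i\<close>.\<close>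

lemma quaternion_pair_eigenvector:
  assumes I: "I \<in> \<A>" "kills (I * I + 1)" and J: "J \<in> \<A>" "kills (J * J + 1)"
    and IJ: "kills (I * J + J * I)"
  obtains v where "v \<in> W" "v \<notin> U" "act I v - v \<bullet>\<^sub>q quat_i \<in> U" "act J v - v \<bullet>\<^sub>q quat_j \<in> U"
proof -
  obtain v where v: "v \<in> W" "v \<notin> U" "act I v - v \<bullet>\<^sub>q quat_i \<in> U"
    using imaginary_unit_eigenspace_nontrivial[OF I] by blast
  define f where "f = (\<lambda>v. v - act J v \<bullet>\<^sub>q quat_j)"
  have f: "f v \<in> W" "act I (f v) - f v \<bullet>\<^sub>q quat_i \<in> U" "act J (f v) - f v \<bullet>\<^sub>q quat_j \<in> U"
    if v: "v \<in> W" "act I v - v \<bullet>\<^sub>q quat_i \<in> U" for v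
  proof -
    show "f v \<in> W"
      using v J by (auto simp: f_def intro: W_closed)
    have "act I (f v) - f v \<bullet>\<^sub>q quat_i = (act I v - v \<bullet>\<^sub>q quat_i) - act (I * J + J * I) v \<bullet>\<^sub>q quat_j
        + act J (act I v - v \<bullet>\<^sub>q quat_i) \<bullet>\<^sub>q quat_j"
      by (simp add: f_def quat_units_mult)
    also have "\<dots> \<in> U"
      using v J IJ unfolding kills_def by (blast intro: U_closed)
    finally show "act I (f v) - f v \<bullet>\<^sub>q quat_i \<in> U" .
    have "act J (f v) - f v \<bullet>\<^sub>q quat_j = - (act (J * J + 1) v \<bullet>\<^sub>q quat_j)"
      by (simp add: f_def quat_units_mult)
    also have "\<dots> \<in> U"
      using v J unfolding kills_def by (blast intro: U_closed)
    finally show "act J (f v) - f v \<bullet>\<^sub>q quat_j \<in> U" .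
  qed
  have vi: "v \<bullet>\<^sub>q quat_i \<in> W" "act I (v \<bullet>\<^sub>q quat_i) - v \<bullet>\<^sub>q quat_i \<bullet>\<^sub>q quat_i \<in> U"
    using v U_closed(6)[OF v(3), of quat_i] by (auto intro: W_closed)
  have "f v \<notin> U \<or> f (v \<bullet>\<^sub>q quat_i) \<notin> U"
  proof (rule ccontr)
    assume "\<not> ?thesis"
    then have "(1 / 2) *\<^sub>R (f v - f (v \<bullet>\<^sub>q quat_i) \<bullet>\<^sub>q quat_i) \<in> U"
      by (auto intro: U_closed)
    moreover have "f v - f (v \<bullet>\<^sub>q quat_i) \<bullet>\<^sub>q quat_i = v + v"
      by (simp add: f_def quat_units_mult mult.assoc)
    ultimately show False
      using v(2) by (simp flip: scaleR_2)
  qed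
  then show ?thesis
    using that f[OF v(1,3)] f[OF vi] by blast
qed

text \<open>This is the proof of Frobenius' theorem, carried out for the algebra of operators on \<open>W / U\<close>,
  together with the choice of a vector on which the units act as scalars.\<close>

lemma common_eigenvector:
  shows "\<exists>v\<in>W. v \<notin> U \<and> (\<forall>x\<in>\<A>. \<exists>c. act x v - v \<bullet>\<^sub>q c \<in> U)"
proof -
  \<comment> \<open>The operators on \<open>W / U\<close> are the reals, the complex numbers
    (\<open>I\<close> central), or the quaternions (\<open>I\<close> not central).\<close>
  consider "\<forall>x\<in>\<A>. \<exists>a. kills (x - a *\<^sub>R 1)"
    | I where "I \<in> \<A>" "kills (I * I + 1)" "\<forall>y\<in>\<A>. kills (I * y - y * I)"
    | I y where "I \<in> \<A>" "kills (I * I + 1)" "y \<in> \<A>" "\<not> kills (I * y - y * I)"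
  proof (cases "\<forall>x\<in>\<A>. \<exists>a. kills (x - a *\<^sub>R 1)")
    case False
    then obtain x where x: "x \<in> \<A>" "\<And>a. \<not> kills (x - a *\<^sub>R 1)"
      by auto
    obtain I where "I \<in> \<A>" "kills (I * I + 1)"
      using real_or_imaginary_unit[OF x] .
    then show ?thesis
      using that(2,3)[of I] by blast
  qed (use that in blast)
  then show ?thesis
  proof cases
    case 1
    obtain v where v: "v \<in> W" "v \<notin> U"
      using U_less_W by blast
    have "\<exists>c. act x v - v \<bullet>\<^sub>q c \<in> U" if x: "x \<in> \<A>" for x
    proof -
      obtain a where "kills (x - a *\<^sub>R 1)"
        using 1 x by blast
      then have "act (x - a *\<^sub>R 1) v \<in> U"
        using v(1) unfolding kills_def by blast
      then show ?thesis
        by (intro exI[of _ "of_real a"]) (simp add: rscale_of_real)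
    qed
    then show ?thesis
      using v by blast
  next
    case 2
    obtain v where v: "v \<in> W" "v \<notin> U" "act I v - v \<bullet>\<^sub>q quat_i \<in> U"
      using imaginary_unit_eigenspace_nontrivial[OF 2(1,2)] by blast
    have "\<exists>c. act x v - v \<bullet>\<^sub>q c \<in> U" if x: "x \<in> \<A>" for x
    proof -
      obtain a b where "kills (x - (a *\<^sub>R 1 + b *\<^sub>R I))"
        using commuting_with_imaginary_unit[OF 2(1,2) x] 2(3) x by blast
      then have "act (x - (a *\<^sub>R 1 + b *\<^sub>R I)) v + b *\<^sub>R (act I v - v \<bullet>\<^sub>q quat_i) \<in> U"
        using v unfolding kills_def by (blast intro: U_closed)
      also have "act (x - (a *\<^sub>R 1 + b *\<^sub>R I)) v + b *\<^sub>R (act I v - v \<bullet>\<^sub>q quat_i)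
          = act x v - v \<bullet>\<^sub>q (of_real a + b *\<^sub>R quat_i)"
        by (simp add: rscale_of_real scaleR_diff_right)
      finally show ?thesis
        by blast
    qed
    then show ?thesis
      using v by blast
  next
    case 3
    obtain J where J: "J \<in> \<A>" "kills (J * J + 1)" "kills (I * J + J * I)"
      using anticommuting_imaginary_unit[OF 3] by blast
    obtain v where v: "v \<in> W" "v \<notin> U" "act I v - v \<bullet>\<^sub>q quat_i \<in> U" "act J v - v \<bullet>\<^sub>q quat_j \<in> U"
      using quaternion_pair_eigenvector[OF 3(1,2) J] .
    have comm: "\<exists>c. act y v - v \<bullet>\<^sub>q c \<in> U" if y: "y \<in> \<A>" "kills (I * y - y * I)" for y
    proof -
      obtain a b where "kills (y - (a *\<^sub>R 1 + b *\<^sub>R I))"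
        using commuting_with_imaginary_unit[OF 3(1,2) y] by blast
      then have "act (y - (a *\<^sub>R 1 + b *\<^sub>R I)) v + b *\<^sub>R (act I v - v \<bullet>\<^sub>q quat_i) \<in> U"
        using v unfolding kills_def by (blast intro: U_closed)
      also have "act (y - (a *\<^sub>R 1 + b *\<^sub>R I)) v + b *\<^sub>R (act I v - v \<bullet>\<^sub>q quat_i)
          = act y v - v \<bullet>\<^sub>q (of_real a + b *\<^sub>R quat_i)"
        by (simp add: rscale_of_real scaleR_diff_right)
      finally show ?thesis
        by blast
    qed
    have "\<exists>c. act x v - v \<bullet>\<^sub>q c \<in> U" if x: "x \<in> \<A>" for x
    proof -
      \<comment> \<open>Modulo the annihilator, \<open>p\<close> commutes with \<open>I\<close> and
        \<open>m\<close> anticommutes with it, and \<open>p + m\<close> is twice \<open>x\<close>.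
        Then \<open>J * m\<close> commutes with \<open>I\<close>, so both \<open>p\<close> and
        \<open>J * m\<close> are covered by \<open>comm\<close>.\<close>
      define p where "p = x - I * x * I"
      define m where "m = x + I * x * I"
      have p: "p \<in> \<A>" and m: "m \<in> \<A>" "J * m \<in> \<A>"
        using x 3 J by (auto simp: p_def m_def intro!: closed)
      have "I * p - p * I = I * x * (I * I + 1) - (I * I + 1) * (x * I)"
        by (simp add: p_def algebra_simps)
      moreover have "kills (I * x * (I * I + 1) - (I * I + 1) * (x * I))"
        using 3 x by (blast intro: kills_closed closed)
      ultimately have "kills (I * p - p * I)"
        by simp
      then obtain c where c: "act p v - v \<bullet>\<^sub>q c \<in> U"
        using comm p by blast
      have "I * (J * m) - J * m * I
          = (I * J + J * I) * m - J * (I * x * (I * I + 1) + (I * I + 1) * (x * I))"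
        by (simp add: m_def algebra_simps)
      moreover have "kills ((I * J + J * I) * m - J * (I * x * (I * I + 1) + (I * I + 1) * (x * I)))"
        using 3 x J m by (blast intro: kills_closed closed)
      ultimately have "kills (I * (J * m) - J * m * I)"
        by simp
      then obtain d where d: "act (J * m) v - v \<bullet>\<^sub>q d \<in> U"
        using comm m by blast
      have Km: "kills ((J * J + 1) * m)"
        using J m by (blast intro: kills_closed closed)
      \<comment> \<open>Modulo \<open>U\<close>, \<open>m v = - J (J m v) = - v j d\<close>, so
        \<open>x\<close> acts on \<open>v\<close> as right multiplication by
        \<open>(c - j d) / 2\<close>.\<close>
      have "(1 / 2) *\<^sub>R ((act p v - v \<bullet>\<^sub>q c) + act ((J * J + 1) * m) v - act J (act (J * m) v - v \<bullet>\<^sub>q d)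
          - (act J v - v \<bullet>\<^sub>q quat_j) \<bullet>\<^sub>q d) \<in> U"
        using c d v J Km unfolding kills_def by (blast intro: U_closed)
      also have "(1 / 2) *\<^sub>R ((act p v - v \<bullet>\<^sub>q c) + act ((J * J + 1) * m) v
          - act J (act (J * m) v - v \<bullet>\<^sub>q d) - (act J v - v \<bullet>\<^sub>q quat_j) \<bullet>\<^sub>q d)
          = (1 / 2) *\<^sub>R (act (p + m) v - v \<bullet>\<^sub>q (c - quat_j * d))"
        by simp
      also have "p + m = 2 *\<^sub>R x"
        by (simp add: p_def m_def scaleR_2)
      also have "(1 / 2) *\<^sub>R (act (2 *\<^sub>R x) v - v \<bullet>\<^sub>q (c - quat_j * d))
          = act x v - v \<bullet>\<^sub>q ((1 / 2) *\<^sub>R (c - quat_j * d))"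
        by (simp only: act_simps scaleR_diff_right rscale_simps) simp
      finally show ?thesis
        by blast
    qed
    then show ?thesis
      using v by blast
  qed
qed

end

section \<open>Triangularization and the trace form\<close>

text \<open>Each strict inclusion raises the dimension. The explicit bound on \<open>k\<close> later
  bounds the length of the words.\<close>

lemma increasing_subspaces_stabilize:
  fixes S :: "nat \<Rightarrow> 'a::euclidean_space set"
  assumes "\<And>k. subspace (S k)" "\<And>k. S k \<subseteq> S (Suc k)"
  obtains k where "k \<le> DIM('a)" "S (Suc k) = S k"
proof (rule ccontr)
  assume *: "\<not> thesis"
  have "k \<le> Suc DIM('a) \<Longrightarrow> k \<le> dim (S k)" for k
  proof (induction k)
    case (Suc k)
    have "S (Suc k) \<noteq> S k"
      using * that[of k] Suc.prems by auto
    then have "dim (S k) < dim (S (Suc k))"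
      using assms subspace_dim_equal[of "S k" "S (Suc k)"] by (metis not_le)
    then show ?case
      using Suc by simp
  qed simp
  from this[of "Suc DIM('a)"] show False
    using dim_subset_UNIV[of "S (Suc DIM('a))"] by simp
qed

lemma quat_subspace_sum:
  "quat_subspace S \<Longrightarrow> (\<And>i. i \<in> I \<Longrightarrow> f i \<in> S) \<Longrightarrow> sum f I \<in> S"
  by (auto intro: subspace_sum dest: quat_subspace_subspace)

lemma rscale_sum: "(\<Sum>i\<in>I. f i) \<bullet>\<^sub>q c = (\<Sum>i\<in>I. f i \<bullet>\<^sub>q c)"
  by (induction I rule: infinite_finite_induct) simp_all

lemma act_sum: "act x (\<Sum>i\<in>I. f i) = (\<Sum>i\<in>I. act x (f i))"
  by (rule linear_sum[OF linear_act])

context trace_negative_algebra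
begin

text \<open>An invariant \<open>W\<close> of least dimension strictly above \<open>U\<close> makes
  \<open>W / U\<close> simple.\<close>

lemma quotient_eigenvector:
  assumes U: "invariant U" "U \<noteq> UNIV"
  obtains v where "v \<notin> U" "\<And>x. x \<in> \<A> \<Longrightarrow> \<exists>c. act x v - v \<bullet>\<^sub>q c \<in> U"
proof -
  have "invariant UNIV \<and> U \<subset> UNIV"
    using U(2) by (auto simp: invariant_def quat_subspace_def)
  then obtain W where W: "invariant W" "U \<subset> W"
    "\<And>S. invariant S \<Longrightarrow> U \<subset> S \<Longrightarrow> dim W \<le> dim S"
    using ex_has_least_nat[of "\<lambda>S. invariant S \<and> U \<subset> S" UNIV dim] by blast
  have "S = U \<or> S = W" if "invariant S" "U \<subseteq> S" "S \<subseteq> W" for S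
  proof (cases "S = U")
    case False
    then have "dim W \<le> dim S"
      using that by (intro W(3)) auto
    then have "S = W"
      using that W(1) by (intro subspace_dim_equal quat_subspace_subspace) (auto simp: invariant_def)
    then show ?thesis
      by simp
  qed simp
  then interpret simple_quotient \<A> U W
    by unfold_locales (use U(1) W in auto)
  show ?thesis
    using common_eigenvector that by blast
qed

end

text \<open>The flag is built by adding the largest index \<open>b\<close>: the span
  \<open>U\<close> of the vectors already chosen is invariant, and the new vector is an eigenvector
  modulo \<open>U\<close>. Taking \<open>I = UNIV\<close> gives a basis in which all of
  \<open>\<A>\<close> is triangular.\<close>

lemma invariant_flag:
  fixes \<A> :: "'n::{finite,linorder} qmat set"
  assumes "trace_negative_algebra \<A>" "finite I"
  shows "\<exists>f :: 'n \<Rightarrow> (quat, 'n) vec. (\<forall>c. (\<Sum>i\<in>I. f i \<bullet>\<^sub>q c i) = 0 \<longrightarrow> (\<forall>i\<in>I. c i = 0)) \<and>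
    (\<forall>x\<in>\<A>. \<forall>i\<in>I. \<exists>c. act x (f i) = (\<Sum>j\<in>{j\<in>I. j \<le> i}. f j \<bullet>\<^sub>q c j))"
  using assms(2)
proof (induction I rule: finite_linorder_max_induct)
  case (insert b I)
  interpret trace_negative_algebra \<A>
    by fact
  obtain f :: "'n \<Rightarrow> (quat, 'n) vec" where f: "\<And>c. (\<Sum>i\<in>I. f i \<bullet>\<^sub>q c i) = 0 \<Longrightarrow> (\<forall>i\<in>I. c i = 0)"
    "\<And>x i. x \<in> \<A> \<Longrightarrow> i \<in> I \<Longrightarrow> \<exists>c. act x (f i) = (\<Sum>j\<in>{j\<in>I. j \<le> i}. f j \<bullet>\<^sub>q c j)"
    using insert.IH by blast
  define U where "U = range (\<lambda>c. \<Sum>i\<in>I. f i \<bullet>\<^sub>q c i)"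
  have sub: "quat_subspace U"
    unfolding quat_subspace_def
  proof (intro conjI ballI allI)
    show "0 \<in> U"
      unfolding U_def by (rule range_eqI[of _ _ "\<lambda>_. 0"]) simp
  next
    fix v w assume "v \<in> U" "w \<in> U"
    then obtain c d where "v = (\<Sum>i\<in>I. f i \<bullet>\<^sub>q c i)" "w = (\<Sum>i\<in>I. f i \<bullet>\<^sub>q d i)"
      unfolding U_def by blast
    then show "v + w \<in> U"
      unfolding U_def by (intro range_eqI[of _ _ "\<lambda>i. c i + d i"]) (simp add: sum.distrib)
  next
    fix v r assume "v \<in> U"
    then obtain c where "v = (\<Sum>i\<in>I. f i \<bullet>\<^sub>q c i)"
      unfolding U_def by blast
    then show "v \<bullet>\<^sub>q r \<in> U"
      unfolding U_def by (intro range_eqI[of _ _ "\<lambda>i. c i * r"]) (simp add: rscale_sum)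
  qed
  have fU: "f j \<bullet>\<^sub>q c \<in> U" if "j \<in> I" for j c
  proof -
    have "f j \<bullet>\<^sub>q c = (\<Sum>i\<in>I. f i \<bullet>\<^sub>q (if i = j then c else 0))"
      using insert.hyps(1) that by (simp add: if_distrib[where f = "\<lambda>x. _ \<bullet>\<^sub>q x"] cong: if_cong)
    then show ?thesis
      unfolding U_def by (intro range_eqI[where x = "\<lambda>i. if i = j then c else 0"])
  qed
  have "act x v \<in> U" if x: "x \<in> \<A>" and v: "v \<in> U" for x v
  proof -
    obtain c where c: "v = (\<Sum>i\<in>I. f i \<bullet>\<^sub>q c i)"
      using v unfolding U_def by blast
    have "act x (f i) \<in> U" if "i \<in> I" for i
    proof -
      obtain d where "act x (f i) = (\<Sum>j\<in>{j\<in>I. j \<le> i}. f j \<bullet>\<^sub>q d j)"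
        using f(2)[OF x \<open>i \<in> I\<close>] by blast
      then show ?thesis
        using fU by (auto intro: quat_subspace_sum[OF sub])
    qed
    then show ?thesis
      unfolding c act_sum act_rscale using sub
      by (intro quat_subspace_sum[OF sub]) (auto simp: quat_subspace_def)
  qed
  then have "invariant U"
    using sub by (simp add: invariant_def)
  moreover have "U \<noteq> UNIV"
  proof
    \<comment> \<open>A surjective real-linear map from \<open>(quat, 'n) vec\<close> to itself is
      injective, but \<open>T\<close> ignores the coordinate \<open>b\<close>.\<close>
    assume U: "U = UNIV"
    define T where "T = (\<lambda>c :: (quat, 'n) vec. \<Sum>i\<in>I. f i \<bullet>\<^sub>q c $ i)"
    have T: "linear T"
      unfolding T_def by (rule linearI) (simp_all add: sum.distrib scaleR_sum_right)
    have "y \<in> range T" for y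
    proof -
      obtain c where "y = (\<Sum>i\<in>I. f i \<bullet>\<^sub>q c i)"
        using U unfolding U_def by blast
      then show ?thesis
        by (intro range_eqI[of _ _ "\<chi> i. c i"]) (simp add: T_def)
    qed
    then have "surj T"
      by blast
    then have "inj T"
      by (rule linear_surjective_imp_injective[OF T]) simp
    moreover have "T (axis b 1) = T 0"
      unfolding T_def using insert.hyps(2) by (intro sum.cong refl) (auto simp: axis_def)
    ultimately have "axis b 1 = (0 :: (quat, 'n) vec)"
      by (rule injD)
    then show False
      by (simp add: axis_eq_0_iff)
  qed
  ultimately obtain v where v: "v \<notin> U" "\<And>x. x \<in> \<A> \<Longrightarrow> \<exists>c. act x v - v \<bullet>\<^sub>q c \<in> U"
    using quotient_eigenvector by blast
  have b: "b \<notin> I" "finite I"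
    using insert.hyps by auto
  define g where "g = f(b := v)"
  have g_sum: "(\<Sum>i\<in>J. g i \<bullet>\<^sub>q c i) = (\<Sum>i\<in>J. f i \<bullet>\<^sub>q c i)" if "J \<subseteq> I" for J c
    using that b by (intro sum.cong refl) (auto simp: g_def)
  have g_insert: "(\<Sum>i\<in>insert b I. g i \<bullet>\<^sub>q c i) = v \<bullet>\<^sub>q c b + (\<Sum>i\<in>I. f i \<bullet>\<^sub>q c i)" for c
    using b by (simp add: g_sum) (simp add: g_def)
  show ?case
  proof (intro exI[of _ g] conjI allI impI ballI)
    fix c i assume c: "(\<Sum>i\<in>insert b I. g i \<bullet>\<^sub>q c i) = 0" and i: "i \<in> insert b I"
    have cb: "c b = 0"
    proof (rule ccontr)
      assume "c b \<noteq> 0"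
      have "v \<bullet>\<^sub>q c b = (\<Sum>i\<in>I. f i \<bullet>\<^sub>q - c i)"
        using c unfolding g_insert by (simp add: sum_negf eq_neg_iff_add_eq_0)
      then have "v \<bullet>\<^sub>q c b \<in> U"
        unfolding U_def by (intro range_eqI[of _ _ "\<lambda>i. - c i"])
      then have "v \<bullet>\<^sub>q c b \<bullet>\<^sub>q inverse (c b) \<in> U"
        using sub unfolding quat_subspace_def by blast
      then show False
        using v(1) \<open>c b \<noteq> 0\<close> by simp
    qed
    then have "(\<Sum>i\<in>I. f i \<bullet>\<^sub>q c i) = 0"
      using c unfolding g_insert by simp
    then show "c i = 0"
      using f(1) i cb by blast
  next
    fix x i assume x: "x \<in> \<A>" and i: "i \<in> insert b I"
    show "\<exists>c. act x (g i) = (\<Sum>j\<in>{j \<in> insert b I. j \<le> i}. g j \<bullet>\<^sub>q c j)"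
    proof (cases "i = b")
      case True
      obtain r where "act x v - v \<bullet>\<^sub>q r \<in> U"
        using v(2)[OF x] by blast
      then obtain d where d: "act x v - v \<bullet>\<^sub>q r = (\<Sum>i\<in>I. f i \<bullet>\<^sub>q d i)"
        unfolding U_def by blast
      have "{j \<in> insert b I. j \<le> i} = insert b I"
        using True insert.hyps by auto
      moreover have "(\<Sum>i\<in>I. f i \<bullet>\<^sub>q (d(b := r)) i) = (\<Sum>i\<in>I. f i \<bullet>\<^sub>q d i)"
        using b by (intro sum.cong refl) auto
      ultimately have "act x (g i) = (\<Sum>j\<in>{j \<in> insert b I. j \<le> i}. g j \<bullet>\<^sub>q (d(b := r)) j)"
        unfolding g_insert using True d by (simp add: g_insert) (simp add: g_def algebra_simps)
      then show ?thesis
        by blast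
    next
      case False
      then have "i \<in> I"
        using i by simp
      then obtain c where c: "act x (f i) = (\<Sum>j\<in>{j\<in>I. j \<le> i}. f j \<bullet>\<^sub>q c j)"
        using f(2)[OF x] by blast
      have "{j \<in> insert b I. j \<le> i} = {j\<in>I. j \<le> i}"
        using insert.hyps \<open>i \<in> I\<close> by force
      then have "act x (g i) = (\<Sum>j\<in>{j \<in> insert b I. j \<le> i}. g j \<bullet>\<^sub>q c j)"
        using False c by (simp add: g_sum) (simp add: g_def)
      then show ?thesis
        by blast
    qed
  qed
qed simp

lemma mat_of_component: "mat_of x $ i $ j = act x (axis j 1) $ i"
  by (simp add: act.rep_eq matrix_vector_mult_def axis_def if_distrib cong: if_cong)

lemma mat_of_qmat [simp]: "mat_of (qmat A) = A"
  by (simp add: qmat_inverse)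

lemma matrix_inv_mult:
  fixes P :: "'a::semiring_1^'n^'m"
  assumes "invertible P"
  shows "P ** matrix_inv P = mat 1" "matrix_inv P ** P = mat 1"
  using assms someI_ex[of "\<lambda>Q. P ** Q = mat 1 \<and> Q ** P = mat 1"]
  by (auto simp: invertible_def matrix_inv_def)

text \<open>Let \<open>q\<close> have the flag basis as columns, and let \<open>r\<close> be its
  inverse, built from preimages of the unit vectors. Column \<open>j\<close> of
  \<open>r * qmat X * q\<close> lists the coordinates of \<open>X\<close> applied to
  \<open>f j\<close>, which vanish beyond \<open>j\<close>.\<close>

lemma trace_negative_imp_triangularizable:
  fixes A B :: "(quat, 'n::{finite,linorder}) sqmat"
  assumes "trace_negative_algebra \<A>" "qmat A \<in> \<A>" "qmat B \<in> \<A>"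
  shows "simultaneously_triangularizable A B"
proof -
  obtain f :: "'n \<Rightarrow> (quat, 'n) vec" where f: "\<And>c. (\<Sum>i\<in>UNIV. f i \<bullet>\<^sub>q c i) = 0 \<Longrightarrow> (\<forall>i. c i = 0)"
    "\<And>x i. x \<in> \<A> \<Longrightarrow> \<exists>c. act x (f i) = (\<Sum>j\<in>{j. j \<le> i}. f j \<bullet>\<^sub>q c j)"
  proof -
    obtain f :: "'n \<Rightarrow> (quat, 'n) vec" where
      "\<forall>c. (\<Sum>i\<in>UNIV. f i \<bullet>\<^sub>q c i) = 0 \<longrightarrow> (\<forall>i\<in>UNIV. c i = 0)"
      "\<forall>x\<in>\<A>. \<forall>i\<in>UNIV. \<exists>c. act x (f i) = (\<Sum>j\<in>{j\<in>UNIV. j \<le> i}. f j \<bullet>\<^sub>q c j)"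
      using invariant_flag[OF assms(1) finite_class.finite_UNIV] by blast
    then show thesis
      by (intro that[of f]) simp_all
  qed
  define q where "q = qmat (\<chi> i j. f j $ i)"
  have act_q: "act q c = (\<Sum>j\<in>UNIV. f j \<bullet>\<^sub>q c $ j)" for c
    by (simp add: q_def act.rep_eq vec_eq_iff matrix_vector_mult_def rscale_def)
  have q_inj: "inj (act q)"
  proof (rule linear_injective_0[OF linear_act, THEN iffD2], safe)
    fix c assume "act q c = 0"
    then show "c = 0"
      using f(1)[of "\<lambda>j. c $ j"] by (simp add: act_q vec_eq_iff)
  qed
  then have surj_q: "surj (act q)"
    by (rule linear_injective_imp_surjective[OF linear_act]) simp
  define w where "w = (\<lambda>k. inv (act q) (axis k 1))"
  have w: "act q (w k) = axis k 1" for k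
    unfolding w_def by (rule surj_f_inv_f[OF surj_q])
  define r where "r = qmat (\<chi> i k. w k $ i)"
  have "act r (axis k 1) = w k" for k
    by (simp add: vec_eq_iff flip: mat_of_component) (simp add: r_def)
  then have "mat_of (q * r) $ i $ k = mat_of 1 $ i $ k" for i k
    by (simp add: mat_of_component w)
  then have qr: "q * r = 1"
    by (simp add: vec_eq_iff flip: mat_of_inject)
  have "act q (act (r * q) v) = act (q * r) (act q v)" for v
    by simp
  then have rq: "r * q = 1"
    using q_inj unfolding qr by (intro act_eqI) (simp add: inj_eq)
  have inv: "mat_of r ** mat_of q = mat 1" "mat_of q ** mat_of r = mat 1"
    using qr rq by (simp_all flip: times_qmat.rep_eq one_qmat.rep_eq)
  then have "invertible (mat_of r)"
    by (auto simp: invertible_def)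
  moreover have "matrix_inv (mat_of r) = mat_of q"
    using matrix_inv_mult(2)[OF \<open>invertible (mat_of r)\<close>] inv(2)
    by (metis inv(1) matrix_mul_assoc matrix_mul_lid matrix_mul_rid)
  moreover have "upper_triangular (mat_of r ** X ** mat_of q)" if X: "qmat X \<in> \<A>" for X
    unfolding upper_triangular_def
  proof (intro allI impI)
    fix i j :: 'n assume "j < i"
    obtain c where c: "act (qmat X) (f j) = (\<Sum>k\<in>{k. k \<le> j}. f k \<bullet>\<^sub>q c k)"
      using f(2)[OF X] by blast
    define d where "d = (\<chi> k. if k \<le> j then c k else 0)"
    have "act q d = (\<Sum>k\<in>UNIV. if k \<le> j then f k \<bullet>\<^sub>q c k else 0)"
      unfolding act_q d_def by (intro sum.cong refl) auto
    also have "\<dots> = act (qmat X) (f j)"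
      using sum.inter_filter[of UNIV "\<lambda>k. f k \<bullet>\<^sub>q c k" "\<lambda>k. k \<le> j"] by (simp add: c)
    finally have "act q d = act (qmat X) (f j)" .
    moreover have "act q (axis j 1) = f j"
      by (simp add: act_q axis_def if_distrib[where f = "\<lambda>x. _ \<bullet>\<^sub>q x"] cong: if_cong)
    ultimately have "act (r * qmat X * q) (axis j 1) = act (r * q) d"
      by simp
    then have "mat_of (r * qmat X * q) $ i $ j = d $ i"
      unfolding mat_of_component rq by simp
    then show "(mat_of r ** X ** mat_of q) $ i $ j = 0"
      using \<open>j < i\<close> by (auto simp: times_qmat.rep_eq d_def)
  qed
  ultimately show ?thesis
    unfolding simultaneously_triangularizable_def using assms(2,3) by metis
qed

section \<open>Words in the two matrices and the trace form\<close>

fun word :: "'n::finite qmat \<Rightarrow> 'n qmat \<Rightarrow> bool list \<Rightarrow> 'n qmat" where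
  "word a b [] = 1"
| "word a b (c # w) = (if c then a else b) * word a b w"

lemma word_append: "word a b (u @ v) = word a b u * word a b v"
  by (induction u) (auto simp: mult.assoc)

text \<open>The bound is the real dimension of the matrix algebra: by
  \<open>span_short_words\<close> longer words add nothing to the span, and the trace form becomes
  finite.\<close>

definition short_words :: "'n::finite itself \<Rightarrow> bool list set" where
  "short_words _ = {w. length w \<le> DIM(quat^'n^'n)}"

lemma finite_short_words: "finite (short_words TYPE('n::finite))"
  using finite_lists_length_le[of "UNIV :: bool set"] by (simp add: short_words_def)

text \<open>The spans \<open>L k\<close> of the words of length at most \<open>k\<close> stop
  growing at some \<open>k\<close> not above the dimension. From then on \<open>L k\<close> is
  stable under left multiplication by \<open>a\<close> and \<open>b\<close>, so it contains all
  words.\<close>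

lemma span_short_words:
  fixes a b :: "'n::finite qmat"
  shows "span (word a b ` short_words TYPE('n)) = span (range (word a b))"
proof
  define L where "L = (\<lambda>k. span (word a b ` {w. length w \<le> k}))"
  have L_mono: "L k \<subseteq> L m" if "k \<le> m" for k m
    unfolding L_def using that by (intro span_mono image_mono) auto
  have lin: "linear (mat_of :: 'n qmat \<Rightarrow> _)"
    by (rule linearI) (simp_all add: plus_qmat.rep_eq scaleR_qmat.rep_eq)
  obtain k where "k \<le> DIM(quat^'n^'n)" "mat_of ` L (Suc k) = mat_of ` L k"
  proof (rule increasing_subspaces_stabilize[of "\<lambda>k. mat_of ` L k"])
    show "subspace (mat_of ` L k)" for k
      unfolding L_def by (intro linear_subspace_image lin subspace_span)
    show "mat_of ` L k \<subseteq> mat_of ` L (Suc k)" for k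
      by (intro image_mono L_mono) simp
  qed
  then have k: "k \<le> DIM(quat^'n^'n)" "L (Suc k) = L k"
    by (auto simp: inj_image_eq_iff inj_def mat_of_inject)
  have step: "c * x \<in> L k" if "x \<in> L k" "c \<in> {a, b}" for c x
  proof -
    have "c * word a b w \<in> L (Suc k)" if "length w \<le> k" for w
      unfolding L_def using \<open>c \<in> {a, b}\<close> that
      by (intro span_base image_eqI[of _ _ "(if c = a then True else False) # w"]) auto
    then have "L k \<subseteq> {x. c * x \<in> L (Suc k)}"
      unfolding L_def by (intro span_minimal)
        (auto simp: subspace_def algebra_simps intro: span_add span_scale span_zero)
    then show ?thesis
      using that(1) k(2) by auto
  qed
  have "word a b w \<in> L k" for w
  proof (induction w)
    case Nil
    show ?case
      unfolding L_def by (intro span_base image_eqI[of _ _ "[]"]) auto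
  qed (simp add: step)
  then have "span (range (word a b)) \<subseteq> L k"
    by (intro span_minimal) (auto simp: L_def)
  also have "\<dots> \<subseteq> L DIM(quat^'n^'n)"
    by (rule L_mono) fact
  finally show "span (range (word a b)) \<subseteq> span (word a b ` short_words TYPE('n))"
    by (simp only: L_def short_words_def)
qed (intro span_mono image_mono subset_UNIV)

lemma qmat_algebra_words: "qmat_algebra (span (range (word a b)))"
proof
  show "1 \<in> span (range (word a b))"
    by (intro span_base range_eqI[of _ _ "[]"]) simp
next
  fix x y assume x: "x \<in> span (range (word a b))" and y: "y \<in> span (range (word a b))"
  have "word a b u * y \<in> span (range (word a b))" for u
  proof -
    have "span (range (word a b)) \<subseteq> {y. word a b u * y \<in> span (range (word a b))}"
      by (intro span_minimal)
        (auto simp: subspace_def algebra_simps word_append[symmetric] intro: span_add span_scale span_zero span_base)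
    then show ?thesis
      using y by auto
  qed
  then have "span (range (word a b)) \<subseteq> {x. x * y \<in> span (range (word a b))}"
    by (intro span_minimal)
      (auto simp: subspace_def algebra_simps intro: span_add span_scale span_zero)
  then show "x * y \<in> span (range (word a b))"
    using x by auto
qed simp

definition word_commutator :: "'n::finite qmat \<Rightarrow> 'n qmat \<Rightarrow> bool list \<times> bool list \<Rightarrow> 'n qmat" where
  "word_commutator a b = (\<lambda>(u, v). word a b u * word a b v - word a b v * word a b u)"

text \<open>The Gram matrix of the word commutators for the bilinear form
  \<open>- trace_re (x * y)\<close>. The sign turns nonpositive traces of squares into positive
  semidefiniteness.\<close>

definition word_form :: "bool list \<times> bool list \<Rightarrow> bool list \<times> bool list
    \<Rightarrow> (quat, 'n::finite) sqmat \<times> (quat, 'n) sqmat \<Rightarrow> real" where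
  "word_form p p' = (\<lambda>(A, B). - trace_re (word_commutator (qmat A) (qmat B) p * word_commutator (qmat A) (qmat B) p'))"

lemma trace_re_sum: "trace_re (\<Sum>i\<in>I. f i) = (\<Sum>i\<in>I. trace_re (f i))"
  by (induction I rule: infinite_finite_induct) simp_all

lemma word_form_sum:
  "(\<Sum>p\<in>I. \<Sum>p'\<in>I. c p * c p' * word_form p p' (A, B))
    = - trace_re ((\<Sum>p\<in>I. c p *\<^sub>R word_commutator (qmat A) (qmat B) p)
      * (\<Sum>p\<in>I. c p *\<^sub>R word_commutator (qmat A) (qmat B) p))"
  by (simp add: word_form_def sum_product trace_re_sum sum_negf mult_ac)

text \<open>The commutator of two combinations of short words is a combination of word commutators
  with coefficients \<open>c u * d v\<close>, so the semidefinite form is evaluated at this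
  vector.\<close>

lemma trace_negative_algebra_words:
  fixes A B :: "(quat, 'n::finite) sqmat"
  defines "I \<equiv> short_words TYPE('n) \<times> short_words TYPE('n)"
  assumes "\<And>c. (\<Sum>p\<in>I. \<Sum>p'\<in>I. c p * c p' * word_form p p' (A, B)) \<ge> 0"
  shows "trace_negative_algebra (span (range (word (qmat A) (qmat B))))"
proof -
  let ?w = "word (qmat A) (qmat B)"
  let ?S = "short_words TYPE('n)"
  interpret qmat_algebra "span (range ?w)"
    by (rule qmat_algebra_words)
  show ?thesis
  proof
    fix x y assume "x \<in> span (range ?w)" "y \<in> span (range ?w)"
    then have "x \<in> span (?w ` ?S)" "y \<in> span (?w ` ?S)"
      by (simp_all add: span_short_words)
    then obtain c d where c: "x = (\<Sum>u\<in>?S. c u *\<^sub>R ?w u)" and d: "y = (\<Sum>v\<in>?S. d v *\<^sub>R ?w v)"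
      using span_finite_image_sum[OF finite_short_words] by metis
    have "x * y = (\<Sum>u\<in>?S. \<Sum>v\<in>?S. (c u * d v) *\<^sub>R (?w u * ?w v))"
      unfolding c d sum_product by (simp add: mult.commute)
    moreover have "y * x = (\<Sum>u\<in>?S. \<Sum>v\<in>?S. (c u * d v) *\<^sub>R (?w v * ?w u))"
      unfolding c d sum_product by (subst sum.swap) (simp add: mult.commute)
    ultimately have "x * y - y * x
        = (\<Sum>p\<in>I. (\<lambda>(u, v). c u * d v) p *\<^sub>R word_commutator (qmat A) (qmat B) p)"
      unfolding I_def
      by (simp add: sum.cartesian_product[symmetric] word_commutator_def scaleR_diff_right sum_subtractf)
        (simp add: sum.cartesian_product case_prod_unfold sum_subtractf[symmetric] scaleR_diff_right)
    then show "trace_re ((x * y - y * x) * (x * y - y * x)) \<le> 0"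
      using assms(2)[of "\<lambda>(u, v). c u * d v"] unfolding word_form_sum by simp
  qed
qed

lemma upper_triangular_mult:
  fixes X Y :: "('a::semiring_1, 'n::{finite,linorder}) sqmat"
  assumes "upper_triangular X" "upper_triangular Y"
  shows "upper_triangular (X ** Y)" "(X ** Y) $ i $ i = X $ i $ i * Y $ i $ i"
proof -
  show "upper_triangular (X ** Y)"
    unfolding upper_triangular_def
  proof (intro allI impI)
    fix i j :: 'n assume "j < i"
    then have "X $ i $ k * Y $ k $ j = 0" for k
      using assms unfolding upper_triangular_def by (cases "k < i") auto
    then show "(X ** Y) $ i $ j = 0"
      by (simp add: matrix_matrix_mult_def)
  qed
  have "X $ i $ k * Y $ k $ i = (if k = i then X $ i $ i * Y $ i $ i else 0)" for k
    using assms unfolding upper_triangular_def by (cases k i rule: linorder_cases) auto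
  then have "(\<Sum>k\<in>UNIV. X $ i $ k * Y $ k $ i) = (\<Sum>k\<in>UNIV. if k = i then X $ i $ i * Y $ i $ i else 0)"
    by (intro sum.cong refl)
  then show "(X ** Y) $ i $ i = X $ i $ i * Y $ i $ i"
    by (simp add: matrix_matrix_mult_def)
qed

lemma Re_q_square_nonpos:
  assumes "Re_q x = 0"
  shows "Re_q (x * x) \<le> 0"
proof -
  have "0 \<le> Im_i x * Im_i x + Im_j x * Im_j x + Im_k x * Im_k x"
    by (intro add_nonneg_nonneg zero_le_square)
  then show ?thesis
    using assms by (simp only: times_quat.simps)
qed

text \<open>Conjugation by \<open>P\<close> preserves products and \<open>trace_re\<close> and makes
  every word triangular. The trace of a square then involves only the squares of diagonal
  entries.\<close>

lemma triangularizable_imp_trace_negative: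
  fixes A B :: "(quat, 'n::{finite,linorder}) sqmat"
  assumes "simultaneously_triangularizable A B"
  shows "(\<Sum>p\<in>I. \<Sum>p'\<in>I. c p * c p' * word_form p p' (A, B)) \<ge> 0"
proof -
  obtain P :: "(quat, 'n) sqmat" where P: "invertible P" "upper_triangular (P ** A ** matrix_inv P)"
    "upper_triangular (P ** B ** matrix_inv P)"
    using assms unfolding simultaneously_triangularizable_def by (elim exE conjE)
  define p where "p = qmat P"
  define p' where "p' = qmat (matrix_inv P)"
  have "matrix_inv P ** P = mat 1"
    using P(1) by (rule matrix_inv_mult)
  then have p'p: "p' * p = 1"
    by (simp add: p_def p'_def times_qmat.rep_eq one_qmat.rep_eq flip: mat_of_inject)
  have "P ** matrix_inv P = mat 1"
    using P(1) by (rule matrix_inv_mult)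
  then have pp': "p * p' = 1"
    by (simp add: p_def p'_def times_qmat.rep_eq one_qmat.rep_eq flip: mat_of_inject)
  define t where "t = (\<lambda>x. p * x * p')"
  have t_mult: "t (x * y) = t x * t y" for x y
  proof -
    have "t x * t y = p * x * (p' * p) * y * p'"
      by (simp only: t_def mult.assoc)
    then show ?thesis
      by (simp add: p'p t_def mult.assoc)
  qed
  have trace_t: "trace_re (t x) = trace_re x" for x
    using trace_re_commute[of p "x * p'"] by (simp add: t_def mult.assoc p'p)
  have "upper_triangular (mat_of (t (word (qmat A) (qmat B) w)))" for w
  proof (induction w)
    case Nil
    show ?case
      by (simp add: t_def pp' one_qmat.rep_eq upper_triangular_def mat_def)
  next
    case (Cons s w)
    have "upper_triangular (mat_of (t (if s then qmat A else qmat B)))"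
      using P(2,3) by (simp add: t_def p_def p'_def times_qmat.rep_eq)
    then show ?case
      using Cons by (simp add: t_mult times_qmat.rep_eq upper_triangular_mult(1))
  qed
  note upper = this
  text \<open>A sum of commutators of quaternions is purely imaginary, so its square is a nonpositive real.\<close>
  define Z where "Z = {x :: 'n qmat. upper_triangular (mat_of x) \<and> (\<forall>i. Re_q (mat_of x $ i $ i) = 0)}"
  have "t (word_commutator (qmat A) (qmat B) q) \<in> Z" for q
  proof -
    obtain u v where q: "q = (u, v)"
      by fastforce
    let ?u = "t (word (qmat A) (qmat B) u)" and ?v = "t (word (qmat A) (qmat B) v)"
    have "t (word_commutator (qmat A) (qmat B) q) = ?u * ?v - ?v * ?u"
      by (simp add: q word_commutator_def t_mult[symmetric]) (simp add: t_def algebra_simps)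
    moreover have "?u * ?v - ?v * ?u \<in> Z"
      using upper_triangular_mult[OF upper[of u] upper[of v]] upper_triangular_mult[OF upper[of v] upper[of u]]
      unfolding Z_def by (simp add: minus_qmat.rep_eq times_qmat.rep_eq upper_triangular_def)
    ultimately show ?thesis
      by simp
  qed
  moreover have "subspace Z"
    unfolding subspace_def Z_def
    by (auto simp: zero_qmat.rep_eq plus_qmat.rep_eq scaleR_qmat.rep_eq upper_triangular_def)
  moreover define z where "z = (\<Sum>p\<in>I. c p *\<^sub>R word_commutator (qmat A) (qmat B) p)"
  moreover have "linear t"
    unfolding t_def by (rule linearI) (simp_all add: algebra_simps)
  ultimately have "t z \<in> Z"
    by (simp add: linear_sum linear_scale subspace_sum subspace_scale)
  then have z: "upper_triangular (mat_of (t z))" "Re_q (mat_of (t z) $ i $ i) = 0" for i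
    unfolding Z_def by auto
  have "trace_re (z * z) = trace_re (t z * t z)"
    by (simp only: trace_t flip: t_mult)
  also have "\<dots> = (\<Sum>i\<in>UNIV. Re_q (mat_of (t z) $ i $ i * mat_of (t z) $ i $ i))"
    unfolding trace_re_def times_qmat.rep_eq upper_triangular_mult(2)[OF z(1) z(1)] ..
  also have "\<dots> \<le> 0"
    using z(2) by (intro sum_nonpos Re_q_square_nonpos)
  finally show ?thesis
    unfolding word_form_sum by (simp add: z_def)
qed

lemma triangularizable_pairs_eq:
  "triangularizable_pairs = {x :: (quat, 'n::{finite,linorder}) sqmat \<times> (quat, 'n) sqmat.
    \<forall>c. (\<Sum>p\<in>short_words TYPE('n) \<times> short_words TYPE('n).
      \<Sum>p'\<in>short_words TYPE('n) \<times> short_words TYPE('n). c p * c p' * word_form p p' x) \<ge> 0}"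
proof -
  have "simultaneously_triangularizable A B \<longleftrightarrow> (\<forall>c. (\<Sum>p\<in>short_words TYPE('n) \<times> short_words TYPE('n).
      \<Sum>p'\<in>short_words TYPE('n) \<times> short_words TYPE('n). c p * c p' * word_form p p' (A, B)) \<ge> 0)"
      (is "?l \<longleftrightarrow> ?r")
    for A B :: "(quat, 'n) sqmat"
  proof
    assume ?l
    then show ?r
      using triangularizable_imp_trace_negative by blast
  next
    assume r: ?r
    have "qmat A \<in> span (range (word (qmat A) (qmat B)))"
      by (intro span_base range_eqI[of _ _ "[True]"]) simp
    moreover have "qmat B \<in> span (range (word (qmat A) (qmat B)))"
      by (intro span_base range_eqI[of _ _ "[False]"]) simp
    ultimately show ?l
      using r by (intro trace_negative_imp_triangularizable[OF trace_negative_algebra_words]) auto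
  qed
  then show ?thesis
    by (auto simp: triangularizable_pairs_def)
qed

section \<open>Polynomiality of the trace form\<close>

definition qmat_polynomial :: "('a::euclidean_space \<Rightarrow> 'n::finite qmat) \<Rightarrow> bool" where
  "qmat_polynomial f \<longleftrightarrow> (\<forall>i j. quat_polynomial (\<lambda>x. mat_of (f x) $ i $ j))"

lemma qmat_polynomial_mult: "qmat_polynomial f \<Longrightarrow> qmat_polynomial g \<Longrightarrow> qmat_polynomial (\<lambda>x. f x * g x)"
  unfolding qmat_polynomial_def
  by (auto simp: times_qmat.rep_eq matrix_matrix_mult_def intro!: quat_polynomial_sum quat_polynomial_mult)

lemma qmat_polynomial_diff: "qmat_polynomial f \<Longrightarrow> qmat_polynomial g \<Longrightarrow> qmat_polynomial (\<lambda>x. f x - g x)"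
  unfolding qmat_polynomial_def by (auto simp: minus_qmat.rep_eq intro: quat_polynomial_diff)

lemma qmat_polynomial_bounded_linear:
  assumes "bounded_linear f"
  shows "qmat_polynomial (\<lambda>x. qmat (f x))"
  unfolding qmat_polynomial_def mat_of_qmat
  by (intro allI quat_polynomial_bounded_linear bounded_linear_compose[OF bounded_linear_vec_nth]
      assms)

lemma qmat_polynomial_word: "qmat_polynomial (\<lambda>x. word (qmat (fst x)) (qmat (snd x)) w)"
proof (induction w)
  case Nil
  show ?case
    by (simp add: qmat_polynomial_def quat_polynomial_const)
next
  case (Cons c w)
  then show ?case
    by (cases c) (simp_all add: qmat_polynomial_mult qmat_polynomial_bounded_linear
        bounded_linear_fst bounded_linear_snd)
qed

lemma real_polynomial_function_trace_re:
  assumes "qmat_polynomial f"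
  shows "real_polynomial_function (\<lambda>x. trace_re (f x))"
  unfolding trace_re_def using assms
  by (intro real_polynomial_function_sum) (auto simp: qmat_polynomial_def quat_polynomial_def)

lemma real_polynomial_function_word_form: "real_polynomial_function (word_form p p')"
proof -
  have "qmat_polynomial (\<lambda>x. word_commutator (qmat (fst x)) (qmat (snd x)) p)" for p
    unfolding word_commutator_def case_prod_unfold
    by (intro qmat_polynomial_diff qmat_polynomial_mult qmat_polynomial_word)
  then show ?thesis
    unfolding word_form_def case_prod_unfold
    by (intro real_polynomial_function_minus real_polynomial_function_trace_re qmat_polynomial_mult)
qed

theorem mainTheorem8:
  shows "semialgebraic
      (triangularizable_pairs :: ((quat, 'n::{finite,linorder}) sqmat \<times> (quat, 'n) sqmat) set)
    \<and> closed
      (triangularizable_pairs :: ((quat, 'n::{finite,linorder}) sqmat \<times> (quat, 'n) sqmat) set)"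
proof
  \<comment> \<open>Cyclicity of the trace supplies the symmetry used by the Schur
    complements.\<close>
  have sym: "word_form p p' x = word_form p' p x" for p p' and x :: "(quat, 'n) sqmat \<times> (quat, 'n) sqmat"
    by (simp add: word_form_def case_prod_unfold trace_re_commute)
  show "semialgebraic
      (triangularizable_pairs :: ((quat, 'n::{finite,linorder}) sqmat \<times> (quat, 'n) sqmat) set)"
    unfolding triangularizable_pairs_eq
    by (intro semialgebraic_psd finite_cartesian_product finite_short_words
        real_polynomial_function_word_form sym)
  show "closed
      (triangularizable_pairs :: ((quat, 'n::{finite,linorder}) sqmat \<times> (quat, 'n) sqmat) set)"
    unfolding triangularizable_pairs_eq by (intro closed_psd real_polynomial_function_word_form)
qed

end
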